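(* Let $$\mathcal D=\operatorname*{arg\,max}_{\|\mathbf o_j\|=1,\ j=1,\dots,m}\Psi(\mathcal O)$$ be a maximizer of $\Psi$ over measurement operators $\mathcal O=(\mathbf o_1,\dots,\mathbf o_m)^t\in(\mathcal H_o^* )^m$ with unit-norm measurements. Then $$(I-\Gamma_{\mathrm{model}}\mathcal D^*\Sigma^{-1}\mathcal D)\,\mathcal F\Gamma_{\mathrm{post}}\mathcal F^*\mathcal D^*\Sigma^{-1}=\mathcal D^*\Xi$$ for some diagonal matrix $\Xi\in\mathbb R^{m\times m}$, where $\Sigma=\Sigma(\mathcal D)$ and $\Gamma_{\mathrm{post}}=\Gamma_{\mathrm{post}}(\mathcal D)$.
   Context: $\mathcal H_p$ and $\mathcal H_o$ are separable real Hilbert spaces and $\mathcal F:\mathcal H_p\to\mathcal H_o$ is a (bounded) linear operator. A measurement operator with $m$ measurements is $\mathcal O=(\mathbf o_1,\dots,\mathbf o_m)^t\in(\mathcal H_o^* )^m$, acting by $\mathcal Ou=(\mathbf o_1(u),\dots,\mathbf o_m(u))^t\in\mathbb R^m$; each $\mathbf o_j$ is identified with its Riesz representative in $\mathcal H_o$, so $\mathcal O^*:\mathbb R^m\to\mathcal H_o$ satisfies $\mathcal O^*e_j=\mathbf o_j$. $\Gamma_{\mathrm{pr}}$ is a positive definite covariance operator on $\mathcal H_p$ (Gaussian prior), $\Gamma_{\mathrm{model}}$ is a covariance operator on $\mathcal H_o$ (self-adjoint, positive semidefinite, possibly zero), and $\sigma^2>0$. Define $$\Sigma(\mathcal O)=\mathcal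 O\Gamma_{\mathrm{model}}\mathcal O^*+\sigma^2I_m,\qquad \Gamma_{\mathrm{post}}(\mathcal O)=(\Gamma_{\mathrm{pr}}^{-1}+\mathcal F^*\mathcal O^*\Sigma(\mathcal O)^{-1}\mathcal O\mathcal F)^{-1},$$ $$\Psi(\mathcal O)=\tfrac12\log\det\big(I+\Gamma_{\mathrm{pr}}^{1/2}\mathcal F^*\mathcal O^*\Sigma(\mathcal O)^{-1}\mathcal O\mathcal F\Gamma_{\mathrm{pr}}^{1/2}\big).$$ Inverses of covariance operators in infinite dimensions are understood as densely defined operators. *)

theory Defs
  imports "Jordan_Normal_Form.Determinant" "HOL-Analysis.Analysis"
begin

no_notation Matrix.vec_index (infixl \<open>$\<close> 100)
no_notation Matrix.scalar_prod (infix \<open>\<bullet>\<close> 70)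

text \<open>Separable real Hilbert spaces are types of sort \<open>{real_inner, polish_space}\<close>: the distance
  of an inner product space is the one given by its norm, and a metric space is separable iff
  it is second countable.\<close>

text \<open>A covariance operator is a bounded, self-adjoint, positive semidefinite operator. No trace class
  condition is imposed; covariance operators of Gaussian measures are a special case.\<close>

definition covariance_operator :: "('a::real_inner \<Rightarrow> 'a) \<Rightarrow> bool" where
  "covariance_operator \<Gamma> \<longleftrightarrow>
     bounded_linear \<Gamma> \<and> (\<forall>x y. \<Gamma> x \<bullet> y = x \<bullet> \<Gamma> y) \<and> (\<forall>x. 0 \<le> x \<bullet> \<Gamma> x)"

definition positive_definite :: "('a::real_inner \<Rightarrow> 'a) \<Rightarrow> bool" where
  "positive_definite \<Gamma> \<longleftrightarrow> (\<forall>x. x \<noteq> 0 \<longrightarrow> 0 < x \<bullet> \<Gamma> x)"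

text \<open>On a Hilbert space a bounded positive semidefinite operator has exactly one positive
  semidefinite square root, so the choice is immaterial.\<close>

definition op_sqrt :: "('a::real_inner \<Rightarrow> 'a) \<Rightarrow> 'a \<Rightarrow> 'a" where
  "op_sqrt \<Gamma> = (SOME S. covariance_operator S \<and> S \<circ> S = \<Gamma>)"

text \<open>The determinant of an operator \<open>T = I + K\<close> with \<open>K\<close> of finite rank: the determinant of the
  restriction of \<open>T\<close> to a finite-dimensional subspace containing the range of \<open>K\<close> (such a
  subspace is \<open>T\<close>-invariant), computed in an orthonormal basis \<open>es\<close> of that subspace. The value does
  not depend on the subspace or the basis, and is the Fredholm determinant of \<open>T\<close>.\<close>

definition op_det :: "('a::real_inner \<Rightarrow> 'a) \<Rightarrow> real" where
  "op_det T = (THE d. \<exists>es.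
     (\<forall>i < length es. \<forall>j < length es. es ! i \<bullet> es ! j = (if i = j then 1 else 0)) \<and>
     range (\<lambda>x. T x - x) \<subseteq> span (set es) \<and>
     d = Determinant.det (Matrix.mat (length es) (length es) (\<lambda>(i, j). es ! i \<bullet> T (es ! j))))"

text \<open>The number \<open>m\<close> of measurements is \<open>CARD('m)\<close>.\<close>

type_synonym ('o, 'm) measurements = "('o \<Rightarrow>\<^sub>L real) ^ 'm"

definition meas_op :: "('o::real_inner, 'm::finite) measurements \<Rightarrow> 'o \<Rightarrow> real ^ 'm" where
  "meas_op D u = (\<chi> j. blinfun_apply (D $ j) u)"

abbreviation meas_adj :: "('o::real_inner, 'm::finite) measurements \<Rightarrow> real ^ 'm \<Rightarrow> 'o" where
  "meas_adj D \<equiv> adjoint (meas_op D)"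

text \<open>\<open>m \<times> m\<close> matrices such as \<open>\<Sigma>(\<O>)\<close> are treated as linear operators on \<open>real ^ 'm\<close>.
  Since \<open>\<sigma>\<^sup>2 > 0\<close>, \<open>\<Sigma>(\<O>)\<close> is a bijection and \<open>inv_into UNIV\<close> is its genuine inverse.\<close>

definition noise_cov ::
  "('o::real_inner \<Rightarrow> 'o) \<Rightarrow> real \<Rightarrow> ('o, 'm::finite) measurements \<Rightarrow> real ^ 'm \<Rightarrow> real ^ 'm" where
  "noise_cov \<Gamma>model \<sigma> D a = meas_op D (\<Gamma>model (meas_adj D a)) + \<sigma>\<^sup>2 *\<^sub>R a"

text \<open>The operator \<open>\<F>\<^sup>* \<O>\<^sup>* \<Sigma>(\<O>)\<inverse> \<O> \<F>\<close>.\<close>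

definition misfit_hessian ::
  "('p::real_inner \<Rightarrow> 'o::real_inner) \<Rightarrow> ('o \<Rightarrow> 'o) \<Rightarrow> real \<Rightarrow>
   ('o, 'm::finite) measurements \<Rightarrow> 'p \<Rightarrow> 'p" where
  "misfit_hessian F \<Gamma>model \<sigma> D =
     adjoint F \<circ> meas_adj D \<circ> inv_into UNIV (noise_cov \<Gamma>model \<sigma> D) \<circ> meas_op D \<circ> F"

text \<open>The unbounded operator \<open>\<Gamma>\<^sub>p\<^sub>r\<inverse>\<close> has the dense domain \<open>range \<Gamma>pr\<close>, which is therefore also the
  domain of \<open>\<Gamma>\<^sub>p\<^sub>r\<inverse> + \<F>\<^sup>* \<O>\<^sup>* \<Sigma>(\<O>)\<inverse> \<O> \<F>\<close>. The latter maps its domain bijectively onto the whole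
  space, so \<open>inv_into\<close> yields its genuine, everywhere defined inverse.\<close>

definition post_cov ::
  "('p::real_inner \<Rightarrow> 'p) \<Rightarrow> ('p \<Rightarrow> 'o::real_inner) \<Rightarrow> ('o \<Rightarrow> 'o) \<Rightarrow> real \<Rightarrow>
   ('o, 'm::finite) measurements \<Rightarrow> 'p \<Rightarrow> 'p" where
  "post_cov \<Gamma>pr F \<Gamma>model \<sigma> D =
     inv_into (range \<Gamma>pr) (\<lambda>u. inv_into UNIV \<Gamma>pr u + misfit_hessian F \<Gamma>model \<sigma> D u)"

definition design_objective ::
  "('p::real_inner \<Rightarrow> 'p) \<Rightarrow> ('p \<Rightarrow> 'o::real_inner) \<Rightarrow> ('o \<Rightarrow> 'o) \<Rightarrow> real \<Rightarrow>
   ('o, 'm::finite) measurements \<Rightarrow> real" where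
  "design_objective \<Gamma>pr F \<Gamma>model \<sigma> D =
     1 / 2 * ln (op_det (\<lambda>v. v + op_sqrt \<Gamma>pr (misfit_hessian F \<Gamma>model \<sigma> D (op_sqrt \<Gamma>pr v))))"

end

theory Submission
  imports Defs
begin

text \<open>
  The objective is an information gain, and information gain obeys a chain rule: learning the
  measurements one at a time multiplies the determinant, at each step, by a ratio of two conditional
  variances. Write \<open>C = \<Gamma>\<^sub>m + F \<Gamma>\<^sub>p F\<^sup>*\<close> for the covariance of the observed field (signal and model
  error together), and let \<open>v\<close> be the \<open>j\<close>-th measurement, all others being held fixed. If \<open>c(v)\<close> is the
  variance of the noisy datum of \<open>v\<close> given the other data under the covariance \<open>C\<close>, and \<open>q(v)\<close> the same
  under \<open>\<Gamma>\<^sub>m\<close>, then the determinant in the objective is a positive number independent of \<open>v\<close> times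
  \<open>c(v) / q(v)\<close> (lemma \<open>op_det_precond_fun_upd\<close>).

  On the unit sphere, with \<open>s = \<sigma>\<^sup>2\<close>, both variances are quadratic forms,
  \<open>c(v) = \<langle>v, (s I + C') v\<rangle>\<close> and \<open>q(v) = \<langle>v, (s I + \<Gamma>') v\<rangle>\<close>, where \<open>C'\<close> and \<open>\<Gamma>'\<close> are the
  conditional covariances given the other data. So an optimal \<open>v\<close> maximizes a generalized Rayleigh
  quotient, whence \<open>q(v) (s v + C' v) = c(v) (s v + \<Gamma>' v)\<close>; no differentiation of determinants is
  involved. After division by \<open>c(v) q(v)\<close> this reads
  \<open>C' v / c(v) - \<Gamma>' v / q(v) = s (1 / q(v) - 1 / c(v)) v\<close>
  (lemma \<open>maximal_variance_ratio_stationary\<close>). By block inversion the two terms on the left are the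
  \<open>j\<close>-th columns of \<open>C D\<^sup>* P\<^sup>-\<^sup>1\<close> and \<open>\<Gamma>\<^sub>m D\<^sup>* \<Sigma>\<^sup>-\<^sup>1\<close>, where \<open>P = D C D\<^sup>* + s I\<close>. Hence
  \<open>C D\<^sup>* P\<^sup>-\<^sup>1 - \<Gamma>\<^sub>m D\<^sup>* \<Sigma>\<^sup>-\<^sup>1 = D\<^sup>* \<Xi>\<close> with the entry \<open>s (1 / q - 1 / c)\<close> of \<open>\<Xi>\<close> in position \<open>(j, j)\<close>.

  Finally \<open>\<Gamma>\<^sub>p\<^sub>o\<^sub>s\<^sub>t F\<^sup>* D\<^sup>* \<Sigma>\<^sup>-\<^sup>1 = \<Gamma>\<^sub>p F\<^sup>* D\<^sup>* P\<^sup>-\<^sup>1\<close>, the two forms of the Kalman gain, and \<open>D F \<Gamma>\<^sub>p F\<^sup>* D\<^sup>* = P - \<Sigma>\<close>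
  turn the left-hand side of the theorem into \<open>C D\<^sup>* P\<^sup>-\<^sup>1 - \<Gamma>\<^sub>m D\<^sup>* \<Sigma>\<^sup>-\<^sup>1\<close>.

  The same chain rule shows that the determinant is well defined and positive: removing the
  measurements one after the other reduces the determinants computed in any two orthonormal lists to
  that of the identity operator, with positive factors that do not depend on the list.
\<close>

section \<open>Representation, adjoints and square roots in Hilbert spaces\<close>

lemma semidefinite_Cauchy_Schwarz:
  fixes M :: "'a::real_inner \<Rightarrow> 'a"
  assumes lin: "linear M" and sym: "\<And>x y. M x \<bullet> y = x \<bullet> M y"
    and pos: "\<And>x. 0 \<le> x \<bullet> M x"
  shows "(x \<bullet> M y)\<^sup>2 \<le> (x \<bullet> M x) * (y \<bullet> M y)"
proof -
  define a b c where "a = x \<bullet> M x" and "b = x \<bullet> M y" and "c = y \<bullet> M y"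
  have expand: "0 \<le> a - 2 * t * b + t\<^sup>2 * c" for t
  proof -
    have "(x - t *\<^sub>R y) \<bullet> M (x - t *\<^sub>R y) = a - 2 * t * b + t\<^sup>2 * c"
      using sym[of x y] unfolding a_def b_def c_def linear_diff[OF lin] linear_scale[OF lin]
      by (simp add: inner_diff_left inner_diff_right inner_commute power2_eq_square algebra_simps)
    then show ?thesis using pos[of "x - t *\<^sub>R y"] by simp
  qed
  have "c \<ge> 0" "a \<ge> 0" unfolding a_def c_def by (rule pos)+
  have "b\<^sup>2 \<le> a * c"
  proof (cases "c = 0")
    case True
    have "b = 0"
    proof (rule ccontr)
      assume "b \<noteq> 0"
      with expand[of "(a + 1) / (2 * b)"] True show False by (simp add: field_simps)
    qed
    then show ?thesis using True by simp
  next
    case False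
    with \<open>c \<ge> 0\<close> have "c > 0" by simp
    have "0 \<le> (a - 2 * (b / c) * b + (b / c)\<^sup>2 * c) * c"
      using expand[of "b / c"] \<open>c > 0\<close> by simp
    also have "\<dots> = a * c - b\<^sup>2" using \<open>c > 0\<close> by (simp add: field_simps power2_eq_square)
    finally show ?thesis by simp
  qed
  then show ?thesis unfolding a_def b_def c_def .
qed

text \<open>
  The representing vector is the minimizer of the energy \<open>\<langle>x, x\<rangle> - 2 f x\<close>. By the parallelogram
  law every minimizing sequence is Cauchy, and the first-order condition at the minimum is the
  representation.
\<close>
lemma Riesz_representation:
  fixes f :: "'a::{real_inner, complete_space} \<Rightarrow> real"
  assumes f: "bounded_linear f"
  shows "\<exists>r. \<forall>x. f x = r \<bullet> x"
proof -
  interpret f: bounded_linear f by (rule f)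
  define J where "J x = x \<bullet> x - 2 * f x" for x
  obtain K where K: "\<And>x. norm (f x) \<le> norm x * K" using f.bounded by blast
  have J_ge: "J x \<ge> - (K\<^sup>2)" for x
  proof -
    have "0 \<le> (norm x - K)\<^sup>2" by simp
    then show ?thesis using K[of x] unfolding J_def
      by (simp add: power2_diff power2_norm_eq_inner abs_le_iff)
  qed
  then have bdd: "bdd_below (range J)" by (intro bdd_belowI[of _ "- (K\<^sup>2)"]) auto
  define m where "m = Inf (range J)"
  have m_le: "m \<le> J x" for x unfolding m_def using bdd by (intro cInf_lower) auto
  have "\<exists>x. J x < m + 1 / real (Suc n)" for n
  proof -
    have "Inf (range J) < m + 1 / real (Suc n)" unfolding m_def by simp
    then show ?thesis using cInf_lessD[of "range J"] by blast
  qed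
  then obtain X where X: "\<And>n. J (X n) < m + 1 / real (Suc n)" by metis
  \<comment> \<open>The parallelogram law, with the midpoint bounded below by the infimum.\<close>
  have para: "(norm (x - y))\<^sup>2 \<le> 2 * (J x - m) + 2 * (J y - m)" for x y
  proof -
    have "(norm (x - y))\<^sup>2 = 2 * J x + 2 * J y - 4 * J ((1/2) *\<^sub>R (x + y))"
      unfolding J_def power2_norm_eq_inner f.scaleR f.add
      by (simp add: inner_diff_left inner_diff_right inner_add_left inner_add_right
          inner_commute algebra_simps)
    then show ?thesis using m_le[of "(1/2) *\<^sub>R (x + y)"] by simp
  qed
  have "Cauchy X"
  proof (rule metric_CauchyI)
    fix e :: real assume "e > 0"
    then have "e\<^sup>2 / 4 > 0" by simp
    then obtain N where N: "1 / real (Suc N) < e\<^sup>2 / 4"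
      using reals_Archimedean[of "e\<^sup>2 / 4"] by (auto simp: inverse_eq_divide)
    have "dist (X i) (X j) < e" if "i \<ge> N" "j \<ge> N" for i j
    proof -
      have le: "J (X k) - m < e\<^sup>2 / 4" if "k \<ge> N" for k
      proof -
        have "1 / real (Suc k) \<le> 1 / real (Suc N)" using that by (simp add: frac_le)
        then show ?thesis using X[of k] N by (smt (verit))
      qed
      have "(norm (X i - X j))\<^sup>2 \<le> 2 * (J (X i) - m) + 2 * (J (X j) - m)"
        by (rule para)
      also have "\<dots> < 2 * (e\<^sup>2 / 4) + 2 * (e\<^sup>2 / 4)"
        by (intro add_strict_mono mult_strict_left_mono le that) simp_all
      finally have "(norm (X i - X j))\<^sup>2 < e\<^sup>2" by simp
      then show ?thesis
        using \<open>e > 0\<close> by (simp add: dist_norm power2_less_imp_less)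
    qed
    then show "\<exists>N. \<forall>i\<ge>N. \<forall>j\<ge>N. dist (X i) (X j) < e" by blast
  qed
  then obtain r where r: "X \<longlonglongrightarrow> r"
    using Cauchy_convergent unfolding convergent_def by blast
  have "(\<lambda>n. J (X n)) \<longlonglongrightarrow> J r"
    unfolding J_def by (intro tendsto_intros r f.tendsto)
  moreover have "(\<lambda>n. m + 1 / real (Suc n)) \<longlonglongrightarrow> m + 0"
    by (intro tendsto_add tendsto_const LIMSEQ_Suc[OF lim_1_over_n])
  ultimately have "J r \<le> m"
    using X LIMSEQ_le[of "\<lambda>n. J (X n)" "J r" "\<lambda>n. m + 1 / real (Suc n)" "m + 0"]
    by (simp add: less_imp_le)
  have "f h = r \<bullet> h" for h
  proof (cases "h = 0")
    case True then show ?thesis by (simp add: f.zero)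
  next
    case False
    \<comment> \<open>The minimizer of the energy on the line through \<open>r\<close> in direction \<open>h\<close>.\<close>
    define t where "t = (f h - r \<bullet> h) / (h \<bullet> h)"
    have pos: "h \<bullet> h > 0" using False by simp
    have "J (r + t *\<^sub>R h) = J r + t\<^sup>2 * (h \<bullet> h) - 2 * t * (f h - r \<bullet> h)"
      unfolding J_def f.scaleR f.add
      by (simp add: inner_add_left inner_add_right inner_commute power2_eq_square algebra_simps)
    also have "f h - r \<bullet> h = t * (h \<bullet> h)" unfolding t_def using pos by simp
    finally have "t\<^sup>2 * (h \<bullet> h) \<le> 0"
      using m_le[of "r + t *\<^sub>R h"] \<open>J r \<le> m\<close> by (simp add: power2_eq_square)
    then have "t = 0" using pos by (simp add: mult_le_0_iff)
    then show ?thesis unfolding t_def using pos by simp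
  qed
  then show ?thesis by blast
qed

lemma inner_adjoint:
  fixes f :: "'a::{real_inner, complete_space} \<Rightarrow> 'b::real_inner"
  assumes "bounded_linear f"
  shows "f x \<bullet> y = x \<bullet> adjoint f y"
proof -
  have "\<exists>r. \<forall>x. f x \<bullet> y = r \<bullet> x" for y
    using Riesz_representation[OF bounded_linear_compose[OF bounded_linear_inner_left assms]] .
  then obtain g where "\<And>x y. f x \<bullet> y = g y \<bullet> x" by metis
  then have g: "\<forall>x y. f x \<bullet> y = x \<bullet> g y" by (simp add: inner_commute)
  then show ?thesis using adjoint_unique[OF g] by simp
qed

lemma linear_if_inner_adjoint:
  fixes g :: "'b::real_inner \<Rightarrow> 'a::real_inner"
  assumes "\<And>x y. f x \<bullet> y = x \<bullet> g y"
  shows "linear g"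
proof (rule linearI)
  fix a b :: 'b and c :: real
  show "g (a + b) = g a + g b"
    by (rule vector_eq_rdot[THEN iffD1]) (metis assms inner_add_right inner_commute)
  show "g (c *\<^sub>R a) = c *\<^sub>R g a"
    by (rule vector_eq_rdot[THEN iffD1]) (metis assms inner_scaleR_right inner_commute)
qed

text \<open>
  If \<open>0 \<le> B \<le> I\<close> and \<open>A = I - B\<close>, then \<open>I - Y\<close> is a square root of \<open>B\<close> exactly when
  \<open>2 Y = A + Y\<^sup>2\<close>. A solution is the limit of the Picard iterates from zero.
\<close>
primrec sqrt_iter :: "('a::real_vector \<Rightarrow> 'a) \<Rightarrow> nat \<Rightarrow> 'a \<Rightarrow> 'a" where
  "sqrt_iter A 0 x = 0"
| "sqrt_iter A (Suc n) x = (1/2) *\<^sub>R (A x + sqrt_iter A n (sqrt_iter A n x))"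

text \<open>
  The iteration for the number \<open>1\<close> in place of \<open>A\<close>. It increases and is bounded, and its increments
  dominate those of \<^const>\<open>sqrt_iter\<close> in operator norm, which makes the operator iteration Cauchy.
\<close>
primrec sqrt_majorant :: "nat \<Rightarrow> real" where
  "sqrt_majorant 0 = 0"
| "sqrt_majorant (Suc n) = (1 + (sqrt_majorant n)\<^sup>2) / 2"

lemma sqrt_majorant_bounds: "0 \<le> sqrt_majorant n" "sqrt_majorant n \<le> 1"
proof (induction n)
  case (Suc n)
  { case 1 show ?case by simp }
  { case 2 show ?case using power_le_one[OF Suc] by simp }
qed simp_all

lemma incseq_sqrt_majorant: "incseq sqrt_majorant"
proof (rule incseq_SucI)
  fix n
  have "0 \<le> (1 - sqrt_majorant n)\<^sup>2" by simp
  then show "sqrt_majorant n \<le> sqrt_majorant (Suc n)" by (simp add: power2_diff)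
qed

lemma linear_sqrt_iter:
  assumes "linear A" shows "linear (sqrt_iter A n)"
proof (induction n)
  case 0 then show ?case by (simp add: linear_iff)
next
  case (Suc n)
  show ?case
    by (rule linearI)
      (simp_all add: linear_add[OF assms] linear_add[OF Suc] linear_scale[OF assms]
        linear_scale[OF Suc] algebra_simps)
qed

lemma norm_sqrt_iter_le:
  assumes "\<And>x. norm (A x) \<le> norm x"
  shows "norm (sqrt_iter A n x) \<le> sqrt_majorant n * norm x"
proof (induction n arbitrary: x)
  case (Suc n)
  have "norm (sqrt_iter A n (sqrt_iter A n x)) \<le> sqrt_majorant n * norm (sqrt_iter A n x)"
    by (rule Suc)
  also have "\<dots> \<le> sqrt_majorant n * (sqrt_majorant n * norm x)"
    by (intro mult_left_mono Suc sqrt_majorant_bounds)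
  finally have "norm (A x + sqrt_iter A n (sqrt_iter A n x)) \<le> norm x + (sqrt_majorant n)\<^sup>2 * norm x"
    using norm_triangle_ineq[of "A x" "sqrt_iter A n (sqrt_iter A n x)"] assms[of x]
    by (simp add: power2_eq_square mult.assoc)
  then have "norm ((1/2) *\<^sub>R (A x + sqrt_iter A n (sqrt_iter A n x)))
      \<le> (norm x + (sqrt_majorant n)\<^sup>2 * norm x) / 2"
    by (simp only: norm_scaleR) simp
  then show ?case by (simp only: sqrt_iter.simps sqrt_majorant.simps) (simp add: field_simps)
qed simp

text \<open>
  The induction rests on \<open>Y\<^sup>2 - X\<^sup>2 = Y (Y - X) + (Y - X) X\<close>; with norms in
  place of operators the right-hand side becomes the difference of squares of the majorant.
\<close>
lemma norm_sqrt_iter_Suc_diff_le: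
  assumes lin: "linear A" and le: "\<And>x. norm (A x) \<le> norm x"
  shows "norm (sqrt_iter A (Suc n) x - sqrt_iter A n x)
    \<le> (sqrt_majorant (Suc n) - sqrt_majorant n) * norm x"
proof (induction n arbitrary: x)
  case 0
  then show ?case using le[of x] by simp
next
  case (Suc n)
  let ?Y = "sqrt_iter A" and ?t = sqrt_majorant
  let ?d = "?t (Suc n) - ?t n"
  have d: "?d \<ge> 0" using incseq_SucD[OF incseq_sqrt_majorant, of n] by simp
  have split: "?Y (Suc n) (?Y (Suc n) x) - ?Y n (?Y n x)
      = ?Y (Suc n) (?Y (Suc n) x - ?Y n x) + (?Y (Suc n) (?Y n x) - ?Y n (?Y n x))"
    by (simp only: linear_diff[OF linear_sqrt_iter[OF lin]]) simp
  have "norm (?Y (Suc n) (?Y (Suc n) x - ?Y n x)) \<le> ?t (Suc n) * norm (?Y (Suc n) x - ?Y n x)"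
    by (rule norm_sqrt_iter_le[OF le])
  also have "\<dots> \<le> ?t (Suc n) * (?d * norm x)"
    by (intro mult_left_mono Suc sqrt_majorant_bounds)
  finally have 1: "norm (?Y (Suc n) (?Y (Suc n) x - ?Y n x)) \<le> ?t (Suc n) * ?d * norm x"
    by (simp only: mult.assoc)
  have "norm (?Y (Suc n) (?Y n x) - ?Y n (?Y n x)) \<le> ?d * norm (?Y n x)"
    by (rule Suc)
  also have "\<dots> \<le> ?d * (?t n * norm x)"
    by (intro mult_left_mono norm_sqrt_iter_le[OF le] d)
  finally have 2: "norm (?Y (Suc n) (?Y n x) - ?Y n (?Y n x)) \<le> ?d * ?t n * norm x"
    by (simp only: mult.assoc)
  have "norm (?Y (Suc n) (?Y (Suc n) x) - ?Y n (?Y n x))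
      \<le> ?t (Suc n) * ?d * norm x + ?d * ?t n * norm x"
    unfolding split by (rule norm_triangle_le[OF add_mono[OF 1 2]])
  also have "\<dots> = ((?t (Suc n))\<^sup>2 - (?t n)\<^sup>2) * norm x"
    by (simp add: power2_eq_square algebra_simps del: sqrt_majorant.simps)
  finally have "norm ((1/2) *\<^sub>R (?Y (Suc n) (?Y (Suc n) x) - ?Y n (?Y n x)))
      \<le> ((?t (Suc n))\<^sup>2 - (?t n)\<^sup>2) / 2 * norm x"
    by simp
  also have "(1/2) *\<^sub>R (?Y (Suc n) (?Y (Suc n) x) - ?Y n (?Y n x)) = ?Y (Suc (Suc n)) x - ?Y (Suc n) x"
    by (simp only: sqrt_iter.simps(2)[of A "Suc n" x] sqrt_iter.simps(2)[of A n x]) (simp only: scaleR_add_right scaleR_diff_right add_diff_add diff_self add_0_left)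
  also have "((?t (Suc n))\<^sup>2 - (?t n)\<^sup>2) / 2 = ?t (Suc (Suc n)) - ?t (Suc n)"
    by (simp only: sqrt_majorant.simps(2)[of "Suc n"] sqrt_majorant.simps(2)[of n]) (simp add: field_simps)
  finally show ?case .
qed

lemma norm_sqrt_iter_diff_le:
  assumes lin: "linear A" and le: "\<And>x. norm (A x) \<le> norm x" and "n \<le> k"
  shows "norm (sqrt_iter A k x - sqrt_iter A n x) \<le> (sqrt_majorant k - sqrt_majorant n) * norm x"
  using \<open>n \<le> k\<close>
proof (induction k rule: dec_induct)
  case (step k)
  have "norm (sqrt_iter A (Suc k) x - sqrt_iter A n x)
      \<le> norm (sqrt_iter A (Suc k) x - sqrt_iter A k x) + norm (sqrt_iter A k x - sqrt_iter A n x)"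
    using norm_triangle_ineq[of "sqrt_iter A (Suc k) x - sqrt_iter A k x" "sqrt_iter A k x - sqrt_iter A n x"]
    by simp
  also have "\<dots> \<le> (sqrt_majorant (Suc k) - sqrt_majorant k) * norm x
      + (sqrt_majorant k - sqrt_majorant n) * norm x"
    by (rule add_mono[OF norm_sqrt_iter_Suc_diff_le[OF lin le] step.IH])
  finally show ?case by (simp only: left_diff_distrib)
qed simp

lemma sqrt_iter_convergent:
  fixes A :: "'a::{real_inner, complete_space} \<Rightarrow> 'a"
  assumes lin: "linear A" and le: "\<And>x. norm (A x) \<le> norm x"
  shows "convergent (\<lambda>n. sqrt_iter A n x)"
proof -
  have "Cauchy (\<lambda>n. sqrt_majorant n * norm x)"
  proof -
    obtain L where "sqrt_majorant \<longlonglongrightarrow> L"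
      using incseq_convergent[OF incseq_sqrt_majorant, of 1] sqrt_majorant_bounds(2) by blast
    then show ?thesis by (intro LIMSEQ_imp_Cauchy[of _ "L * norm x"] tendsto_intros)
  qed
  have "Cauchy (\<lambda>n. sqrt_iter A n x)"
  proof (rule metric_CauchyI)
    fix e :: real assume "e > 0"
    with \<open>Cauchy (\<lambda>n. sqrt_majorant n * norm x)\<close>
    obtain N where N: "\<And>i j. i \<ge> N \<Longrightarrow> j \<ge> N \<Longrightarrow>
        dist (sqrt_majorant i * norm x) (sqrt_majorant j * norm x) < e"
      unfolding Cauchy_def by blast
    have *: "dist (sqrt_iter A i x) (sqrt_iter A j x) < e" if "i \<ge> N" "j \<ge> i" for i j
      using norm_sqrt_iter_diff_le[OF lin le, of i j x] N[of j i] that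
      by (simp add: dist_norm norm_minus_commute left_diff_distrib abs_less_iff)
    have "dist (sqrt_iter A i x) (sqrt_iter A j x) < e" if "i \<ge> N" "j \<ge> N" for i j
      using *[of i j] *[of j i] that by (cases "i \<le> j") (auto simp: dist_commute)
    then show "\<exists>N. \<forall>i\<ge>N. \<forall>j\<ge>N. dist (sqrt_iter A i x) (sqrt_iter A j x) < e" by blast
  qed
  then show ?thesis by (rule Cauchy_convergent)
qed

lemma sqrt_iter_selfadjoint:
  fixes A :: "'a::real_inner \<Rightarrow> 'a"
  assumes "\<And>x y. A x \<bullet> y = x \<bullet> A y"
  shows "sqrt_iter A n x \<bullet> y = x \<bullet> sqrt_iter A n y"
  by (induction n arbitrary: x y)
    (simp_all add: inner_add_left inner_add_right assms)

text \<open>The strong limit of the iterates inherits linearity, symmetry and the norm bound.\<close>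
lemma sqrt_iter_limit_fixpoint:
  fixes A :: "'a::{real_inner, complete_space} \<Rightarrow> 'a"
  assumes lin: "linear A" and le: "\<And>x. norm (A x) \<le> norm x"
    and sym: "\<And>x y. A x \<bullet> y = x \<bullet> A y"
  obtains Y where "linear Y" "\<And>x. norm (Y x) \<le> norm x" "\<And>x y. Y x \<bullet> y = x \<bullet> Y y"
    "\<And>x. 2 *\<^sub>R Y x = A x + Y (Y x)"
proof -
  define Y where "Y x = lim (\<lambda>n. sqrt_iter A n x)" for x
  have Y: "(\<lambda>n. sqrt_iter A n x) \<longlonglongrightarrow> Y x" for x
    using sqrt_iter_convergent[OF lin le] unfolding Y_def by (simp add: convergent_LIMSEQ_iff)
  note lin_n = linear_sqrt_iter[OF lin]
  have norm_n: "norm (sqrt_iter A n x) \<le> norm x" for n x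
    by (rule order_trans[OF norm_sqrt_iter_le[OF le]])
      (simp add: mult_left_le_one_le sqrt_majorant_bounds)
  have "linear Y"
  proof (rule linearI)
    fix a b :: 'a and c :: real
    have "(\<lambda>n. sqrt_iter A n (a + b)) \<longlonglongrightarrow> Y a + Y b"
      unfolding linear_add[OF lin_n] by (intro tendsto_add Y)
    then show "Y (a + b) = Y a + Y b" using Y LIMSEQ_unique by blast
    have "(\<lambda>n. sqrt_iter A n (c *\<^sub>R a)) \<longlonglongrightarrow> c *\<^sub>R Y a"
      unfolding linear_scale[OF lin_n] by (intro tendsto_scaleR tendsto_const Y)
    then show "Y (c *\<^sub>R a) = c *\<^sub>R Y a" using Y LIMSEQ_unique by blast
  qed
  moreover have "norm (Y x) \<le> norm x" for x
    by (rule LIMSEQ_le_const2[OF tendsto_norm[OF Y]]) (auto intro: norm_n)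
  moreover have "Y x \<bullet> y = x \<bullet> Y y" for x y
  proof -
    have "(\<lambda>n. sqrt_iter A n x \<bullet> y) \<longlonglongrightarrow> Y x \<bullet> y" by (intro tendsto_intros Y)
    moreover have "(\<lambda>n. sqrt_iter A n x \<bullet> y) \<longlonglongrightarrow> x \<bullet> Y y"
      unfolding sqrt_iter_selfadjoint[OF sym] by (intro tendsto_intros Y)
    ultimately show ?thesis by (rule LIMSEQ_unique)
  qed
  moreover have "2 *\<^sub>R Y x = A x + Y (Y x)" for x
  proof -
    \<comment> \<open>The iterates are uniformly bounded, so the limit may be taken in both factors of \<open>Y\<^sub>n Y\<^sub>n\<close> at once.\<close>
    have "(\<lambda>n. sqrt_iter A n (sqrt_iter A n x - Y x)) \<longlonglongrightarrow> 0"
    proof (rule Lim_null_comparison)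
      show "\<forall>\<^sub>F n in sequentially. norm (sqrt_iter A n (sqrt_iter A n x - Y x)) \<le> norm (sqrt_iter A n x - Y x)"
        by (simp add: norm_n)
      show "(\<lambda>n. norm (sqrt_iter A n x - Y x)) \<longlonglongrightarrow> 0"
        using Y[of x] by (simp add: LIM_zero tendsto_norm_zero)
    qed
    then have "(\<lambda>n. sqrt_iter A n (sqrt_iter A n x - Y x) + sqrt_iter A n (Y x)) \<longlonglongrightarrow> 0 + Y (Y x)"
      by (intro tendsto_add Y)
    then have "(\<lambda>n. sqrt_iter A n (sqrt_iter A n x)) \<longlonglongrightarrow> Y (Y x)"
      by (simp add: linear_diff[OF lin_n])
    then have "(\<lambda>n. (1/2) *\<^sub>R (A x + sqrt_iter A n (sqrt_iter A n x))) \<longlonglongrightarrow> (1/2) *\<^sub>R (A x + Y (Y x))"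
      by (intro tendsto_intros)
    moreover have "(\<lambda>n. (1/2) *\<^sub>R (A x + sqrt_iter A n (sqrt_iter A n x))) \<longlonglongrightarrow> Y x"
      using LIMSEQ_Suc[OF Y[of x]] by simp
    ultimately have "(1/2) *\<^sub>R (A x + Y (Y x)) = Y x" by (rule LIMSEQ_unique)
    then show ?thesis by (metis scaleR_half_double scaleR_2 scaleR_add_right scaleR_left_distrib)
  qed
  ultimately show ?thesis by (rule that)
qed

lemma covariance_sqrt_exists:
  fixes \<Gamma> :: "'a::{real_inner, complete_space} \<Rightarrow> 'a"
  assumes "covariance_operator \<Gamma>"
  shows "\<exists>S. covariance_operator S \<and> S \<circ> S = \<Gamma>"
proof -
  have bl: "bounded_linear \<Gamma>" and sym: "\<And>x y. \<Gamma> x \<bullet> y = x \<bullet> \<Gamma> y" and pos: "\<And>x. 0 \<le> x \<bullet> \<Gamma> x"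
    using assms unfolding covariance_operator_def by auto
  have lin: "linear \<Gamma>" using bl by (rule bounded_linear.linear)
  obtain c where c: "c > 0" and bound: "\<And>x. norm (\<Gamma> x) \<le> norm x * c"
    using bounded_linear.pos_bounded[OF bl] by blast
  \<comment> \<open>Scaling to \<open>0 \<le> B \<le> I\<close>, so that \<open>I - B\<close> is a contraction.\<close>
  define B where "B x = (1 / c) *\<^sub>R \<Gamma> x" for x
  have linB: "linear B" unfolding B_def
    by (rule linearI) (simp_all add: linear_add[OF lin] linear_scale[OF lin] algebra_simps)
  have symB: "B x \<bullet> y = x \<bullet> B y" for x y unfolding B_def by (simp add: sym)
  have posB: "0 \<le> x \<bullet> B x" for x unfolding B_def using pos[of x] c by simp
  have leB: "x \<bullet> B x \<le> x \<bullet> x" for x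
  proof -
    have "x \<bullet> \<Gamma> x \<le> norm x * norm (\<Gamma> x)" by (rule norm_cauchy_schwarz)
    also have "\<dots> \<le> norm x * (norm x * c)" by (intro mult_left_mono bound) simp
    also have "\<dots> = c * (x \<bullet> x)" by (simp add: dot_square_norm power2_eq_square)
    finally show ?thesis unfolding B_def using c by (simp add: field_simps)
  qed
  have norm_sq: "B x \<bullet> B x \<le> x \<bullet> B x" for x
  proof -
    have "(B x \<bullet> B x)\<^sup>2 \<le> (B x \<bullet> B (B x)) * (x \<bullet> B x)"
      using semidefinite_Cauchy_Schwarz[OF linB symB posB, of "B x" x] .
    also have "\<dots> \<le> (B x \<bullet> B x) * (x \<bullet> B x)"
      by (intro mult_right_mono leB posB)
    finally have "(B x \<bullet> B x) * (B x \<bullet> B x) \<le> (B x \<bullet> B x) * (x \<bullet> B x)"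
      by (simp add: power2_eq_square)
    then show ?thesis using posB[of x] by (cases "B x = 0") (simp_all add: mult_le_cancel_left)
  qed
  define A where "A x = x - B x" for x
  have linA: "linear A" unfolding A_def
    by (rule linearI) (simp_all add: linear_add[OF linB] linear_scale[OF linB] algebra_simps)
  have symA: "A x \<bullet> y = x \<bullet> A y" for x y
    unfolding A_def by (simp add: inner_diff_left inner_diff_right symB)
  have leA: "norm (A x) \<le> norm x" for x
  proof (rule power2_le_imp_le)
    have "B x \<bullet> x = x \<bullet> B x" by (rule inner_commute)
    then show "(norm (A x))\<^sup>2 \<le> (norm x)\<^sup>2"
      using norm_sq[of x] posB[of x] unfolding power2_norm_eq_inner A_def
      by (simp add: inner_diff_left inner_diff_right)
  qed simp
  obtain Y where Y: "linear Y" "\<And>x. norm (Y x) \<le> norm x" "\<And>x y. Y x \<bullet> y = x \<bullet> Y y"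
    "\<And>x. 2 *\<^sub>R Y x = A x + Y (Y x)"
    using sqrt_iter_limit_fixpoint[OF linA leA symA] by blast
  define S where "S x = sqrt c *\<^sub>R (x - Y x)" for x
  have linS: "linear S" unfolding S_def
    by (rule linearI) (simp_all add: linear_add[OF Y(1)] linear_scale[OF Y(1)] algebra_simps)
  have normS: "norm (S x) \<le> norm x * (sqrt c * 2)" for x
  proof -
    have "norm (x - Y x) \<le> norm x * 2"
      using norm_triangle_ineq4[of x "Y x"] Y(2)[of x] by simp
    then show ?thesis using c unfolding S_def by (simp add: mult.assoc)
  qed
  have "bounded_linear S"
    using linS normS by (simp add: bounded_linear_def bounded_linear_axioms_def) blast
  moreover have "S x \<bullet> y = x \<bullet> S y" for x y
    unfolding S_def by (simp add: inner_diff_left inner_diff_right Y(3))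
  moreover have "0 \<le> x \<bullet> S x" for x
  proof -
    have "x \<bullet> Y x \<le> norm x * norm (Y x)" by (rule norm_cauchy_schwarz)
    also have "\<dots> \<le> norm x * norm x" by (intro mult_left_mono Y(2)) simp
    finally show ?thesis
      using c unfolding S_def by (simp add: inner_diff_right dot_square_norm power2_eq_square)
  qed
  moreover have "S (S x) = \<Gamma> x" for x
  proof -
    have "S (S x) = (sqrt c * sqrt c) *\<^sub>R (x - Y x - Y (x - Y x))"
      unfolding S_def linear_scale[OF Y(1)] by (simp add: algebra_simps)
    also have "x - Y x - Y (x - Y x) = x - 2 *\<^sub>R Y x + Y (Y x)"
      by (simp add: linear_diff[OF Y(1)] scaleR_2)
    also have "\<dots> = B x" unfolding Y(4) A_def by simp
    finally show ?thesis using c unfolding B_def by simp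
  qed
  ultimately show ?thesis unfolding covariance_operator_def by (intro exI[of _ S]) auto
qed

lemma op_sqrt:
  fixes \<Gamma> :: "'a::{real_inner, complete_space} \<Rightarrow> 'a"
  assumes "covariance_operator \<Gamma>"
  shows "covariance_operator (op_sqrt \<Gamma>)" "op_sqrt \<Gamma> (op_sqrt \<Gamma> x) = \<Gamma> x"
proof -
  have "covariance_operator (op_sqrt \<Gamma>) \<and> op_sqrt \<Gamma> \<circ> op_sqrt \<Gamma> = \<Gamma>"
    using covariance_sqrt_exists[OF assms] unfolding op_sqrt_def by (rule someI_ex)
  then show "covariance_operator (op_sqrt \<Gamma>)" "op_sqrt \<Gamma> (op_sqrt \<Gamma> x) = \<Gamma> x"
    by (auto simp: fun_eq_iff)
qed

section \<open>Updating noisy observations by one measurement\<close>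

text \<open>
  A design is a family \<open>r\<close> of Riesz representatives, and a zero entry stands for a measurement that is
  absent: its datum is pure noise, independent of the others. Adding a measurement is thus a
  function update at an index where \<open>r\<close> vanishes, and the number of data never changes.
\<close>
definition obs :: "('m::finite \<Rightarrow> 'o::real_inner) \<Rightarrow> 'o \<Rightarrow> real ^ 'm" where
  "obs r u = (\<chi> k. r k \<bullet> u)"

definition obs_adj :: "('m::finite \<Rightarrow> 'o::real_inner) \<Rightarrow> real ^ 'm \<Rightarrow> 'o" where
  "obs_adj r a = (\<Sum>k\<in>UNIV. (a $ k) *\<^sub>R r k)"

definition obs_cov :: "('o::real_inner \<Rightarrow> 'o) \<Rightarrow> real \<Rightarrow> ('m::finite \<Rightarrow> 'o) \<Rightarrow> real ^ 'm \<Rightarrow> real ^ 'm" where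
  "obs_cov M s r a = obs r (M (obs_adj r a)) + s *\<^sub>R a"

definition obs_prec :: "('o::real_inner \<Rightarrow> 'o) \<Rightarrow> real \<Rightarrow> ('m::finite \<Rightarrow> 'o) \<Rightarrow> real ^ 'm \<Rightarrow> real ^ 'm" where
  "obs_prec M s r = inv_into UNIV (obs_cov M s r)"

text \<open>
  For a random field with covariance \<open>M\<close>, observed through \<open>r\<close> with independent noise of variance \<open>s\<close>,
  the representative of a measurement \<open>v\<close> minus that of its best linear predictor from the data.
\<close>
definition resid :: "('o::real_inner \<Rightarrow> 'o) \<Rightarrow> real \<Rightarrow> ('m::finite \<Rightarrow> 'o) \<Rightarrow> 'o \<Rightarrow> 'o" where
  "resid M s r v = v - obs_adj r (obs_prec M s r (obs r (M v)))"

text \<open>The variance of a further noisy datum of \<open>v\<close>, conditional on the data from \<open>r\<close>.\<close>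
definition cond_var :: "('o::real_inner \<Rightarrow> 'o) \<Rightarrow> real \<Rightarrow> ('m::finite \<Rightarrow> 'o) \<Rightarrow> 'o \<Rightarrow> real" where
  "cond_var M s r v = s + v \<bullet> M (resid M s r v)"

lemma linear_obs: "linear (obs r)"
  by (rule linearI) (simp_all add: obs_def vec_eq_iff inner_add_right)

lemma linear_obs_adj: "linear (obs_adj r)"
  by (rule linearI)
    (simp_all add: obs_adj_def scaleR_add_left sum.distrib scaleR_sum_right)

lemma obs_adj_inner: "obs_adj r a \<bullet> u = a \<bullet> obs r u"
  by (simp add: obs_adj_def obs_def inner_vec_def inner_sum_left)

lemma inner_obs_adj: "u \<bullet> obs_adj r a = obs r u \<bullet> a"
  using obs_adj_inner[of r a u] by (simp only: inner_commute)

lemma obs_adj_axis: "obs_adj r (axis k 1) = r k"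
proof -
  have "obs_adj r (axis k 1) = (\<Sum>i\<in>UNIV. if i = k then r k else 0)"
    unfolding obs_adj_def by (rule sum.cong) (auto simp: axis_def)
  then show ?thesis by simp
qed

lemma obs_fun_upd: "r j = 0 \<Longrightarrow> obs (r(j := v)) u = obs r u + (v \<bullet> u) *\<^sub>R axis j 1"
  by (simp add: obs_def vec_eq_iff axis_def)

lemma obs_adj_fun_upd: "r j = 0 \<Longrightarrow> obs_adj (r(j := v)) a = obs_adj r a + (a $ j) *\<^sub>R v"
proof -
  assume j: "r j = 0"
  have "obs_adj (r(j := v)) a = (\<Sum>k\<in>UNIV. (a $ k) *\<^sub>R r k + (if k = j then (a $ j) *\<^sub>R v else 0))"
    unfolding obs_adj_def by (rule sum.cong) (auto simp: j)
  then show ?thesis by (simp add: obs_adj_def sum.distrib)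
qed

locale noisy_obs =
  fixes M :: "'o::real_inner \<Rightarrow> 'o" and s :: real
  assumes linear_M: "linear M"
    and sym_M: "M x \<bullet> y = x \<bullet> M y"
    and pos_M: "0 \<le> x \<bullet> M x"
    and s_pos: "0 < s"
begin

lemma linear_obs_cov: "linear (obs_cov M s r)"
  by (rule linearI)
    (simp_all add: obs_cov_def linear_add[OF linear_obs] linear_add[OF linear_obs_adj]
      linear_add[OF linear_M] linear_scale[OF linear_obs] linear_scale[OF linear_obs_adj]
      linear_scale[OF linear_M] scaleR_add_right)

lemma obs_cov_sym: "obs_cov M s r a \<bullet> b = a \<bullet> obs_cov M s r b"
proof -
  have "obs r (M (obs_adj r a)) \<bullet> b = M (obs_adj r a) \<bullet> obs_adj r b"
    by (rule inner_obs_adj[symmetric])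
  also have "\<dots> = a \<bullet> obs r (M (obs_adj r b))" by (simp only: sym_M obs_adj_inner)
  finally show ?thesis by (simp add: obs_cov_def inner_add_left inner_add_right)
qed

lemma obs_cov_pos: "s * (a \<bullet> a) \<le> a \<bullet> obs_cov M s r a"
  using pos_M[of "obs_adj r a"] by (simp add: obs_cov_def inner_add_right flip: obs_adj_inner)

lemma inj_obs_cov: "inj (obs_cov M s r)"
proof (rule linear_injective_0[OF linear_obs_cov, THEN iffD2], intro allI impI)
  fix a assume "obs_cov M s r a = 0"
  with obs_cov_pos[of a r] have "a \<bullet> a \<le> 0" using s_pos by (simp add: mult_le_0_iff)
  then show "a = 0" by (metis inner_gt_zero_iff not_le)
qed

lemma obs_cov_prec [simp]: "obs_cov M s r (obs_prec M s r a) = a"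
proof -
  have "surj (obs_cov M s r)"
    using linear_injective_imp_surjective[OF linear_obs_cov inj_obs_cov] by blast
  then show ?thesis unfolding obs_prec_def by (rule surj_f_inv_f)
qed

lemma obs_prec_eqI: "obs_cov M s r b = a \<Longrightarrow> obs_prec M s r a = b"
  unfolding obs_prec_def by (metis inv_f_f inj_obs_cov)

lemma linear_obs_prec: "linear (obs_prec M s r)"
  by (rule linearI; rule obs_prec_eqI)
    (simp_all add: linear_add[OF linear_obs_cov] linear_scale[OF linear_obs_cov])

lemma obs_prec_sym: "obs_prec M s r a \<bullet> b = a \<bullet> obs_prec M s r b"
  using obs_cov_sym[of r "obs_prec M s r a" "obs_prec M s r b"] by simp

lemma obs_prec_pos: "0 \<le> a \<bullet> obs_prec M s r a"
proof -
  have "0 \<le> s * (obs_prec M s r a \<bullet> obs_prec M s r a)" using s_pos by simp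
  then show ?thesis using obs_cov_pos[of "obs_prec M s r a" r] by (simp add: inner_commute)
qed

lemma obs_prec_inner_eq_0: "a \<bullet> obs_prec M s r a = 0 \<Longrightarrow> a = 0"
proof -
  assume "a \<bullet> obs_prec M s r a = 0"
  then have "s * (obs_prec M s r a \<bullet> obs_prec M s r a) \<le> 0"
    using obs_cov_pos[of "obs_prec M s r a" r] by (simp add: inner_commute)
  then have "obs_prec M s r a \<bullet> obs_prec M s r a \<le> 0" using s_pos by (simp add: mult_le_0_iff)
  then have "obs_prec M s r a = 0" by (metis inner_gt_zero_iff not_le)
  then show "a = 0" using obs_cov_prec[of r a] linear_0[OF linear_obs_cov, of r] by simp
qed

lemma linear_resid: "linear (resid M s r)"
  by (rule linearI)
    (simp_all add: resid_def linear_add[OF linear_obs] linear_add[OF linear_obs_adj]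
      linear_add[OF linear_M] linear_add[OF linear_obs_prec] linear_scale[OF linear_obs]
      linear_scale[OF linear_obs_adj] linear_scale[OF linear_M] linear_scale[OF linear_obs_prec]
      scaleR_diff_right)

text \<open>\<open>M \<circ> resid\<close> is the conditional covariance operator given the data.\<close>
lemma resid_sym: "M (resid M s r v) \<bullet> w = v \<bullet> M (resid M s r w)"
proof -
  have "M (obs_adj r (obs_prec M s r (obs r (M v)))) \<bullet> w
      = obs_prec M s r (obs r (M v)) \<bullet> obs r (M w)"
    by (simp only: sym_M obs_adj_inner)
  also have "\<dots> = M v \<bullet> obs_adj r (obs_prec M s r (obs r (M w)))"
    by (simp only: obs_prec_sym inner_obs_adj)
  also have "\<dots> = v \<bullet> M (obs_adj r (obs_prec M s r (obs r (M w))))" by (rule sym_M)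
  finally show ?thesis
    by (simp add: resid_def linear_diff[OF linear_M] inner_diff_left inner_diff_right sym_M)
qed

lemma obs_resid: "obs r (M (resid M s r v)) = s *\<^sub>R obs_prec M s r (obs r (M v))"
proof -
  let ?y = "obs_prec M s r (obs r (M v))"
  have "obs r (M (obs_adj r ?y)) + s *\<^sub>R ?y = obs r (M v)"
    using obs_cov_prec[of r "obs r (M v)"] by (simp only: obs_cov_def)
  then show ?thesis
    by (simp add: resid_def linear_diff[OF linear_M] linear_diff[OF linear_obs] algebra_simps)
qed

lemma obs_prec_component_0:
  assumes "r j = 0" shows "obs_prec M s r (obs r u) $ j = 0"
proof -
  have "obs_cov M s r (obs_prec M s r (obs r u)) $ j = obs r u $ j" by simp
  then show ?thesis using s_pos by (simp add: obs_cov_def obs_def assms)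
qed

text \<open>
  Block elimination: the vector \<open>z\<close> carries a one at the new measurement and minus the prediction
  weights at the old ones. The data covariance sends it to a multiple of the unit vector, so up to
  that multiple, the Schur complement \<open>cond_var\<close>, it is the new column of the inverse.
\<close>
lemma obs_cov_fun_upd_column:
  fixes r :: "'m::finite \<Rightarrow> 'o" and v :: 'o
  assumes j: "r j = 0"
  defines "z \<equiv> axis j 1 - obs_prec M s r (obs r (M v))"
  shows "obs_cov M s (r(j := v)) z = cond_var M s r v *\<^sub>R axis j 1"
    and "obs_adj (r(j := v)) z = resid M s r v"
    and "z $ j = 1"
proof -
  show zj: "z $ j = 1" by (simp add: z_def axis_def obs_prec_component_0[where r = r, OF j])
  show adj: "obs_adj (r(j := v)) z = resid M s r v"
    unfolding obs_adj_fun_upd[of r, OF j] zj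
    by (simp add: z_def linear_diff[OF linear_obs_adj] obs_adj_axis j resid_def)
  have "obs_cov M s (r(j := v)) z
      = obs r (M (resid M s r v)) + (v \<bullet> M (resid M s r v)) *\<^sub>R axis j 1 + s *\<^sub>R z"
    unfolding obs_cov_def adj by (simp add: obs_fun_upd[of r, OF j])
  also have "\<dots> = cond_var M s r v *\<^sub>R axis j 1"
    unfolding obs_resid by (simp add: z_def cond_var_def algebra_simps)
  finally show "obs_cov M s (r(j := v)) z = cond_var M s r v *\<^sub>R axis j 1" .
qed

lemma cond_var_pos:
  fixes r :: "'m::finite \<Rightarrow> 'o"
  assumes j: "r j = 0" shows "0 < cond_var M s r v"
proof -
  define z where "z = axis j 1 - obs_prec M s r (obs r (M v))"
  note z = obs_cov_fun_upd_column[where r = r, OF j, of v, folded z_def]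
  have "z \<noteq> 0" using z(3) by auto
  then have "0 < s * (z \<bullet> z)" using s_pos by simp
  also have "\<dots> \<le> z \<bullet> obs_cov M s (r(j := v)) z" by (rule obs_cov_pos)
  also have "\<dots> = cond_var M s r v" unfolding z(1) using z(3) by (simp add: inner_axis)
  finally show ?thesis .
qed

lemma obs_adj_prec_axis:
  assumes j: "r j = 0"
  shows "obs_adj (r(j := v)) (obs_prec M s (r(j := v)) (axis j 1))
    = (1 / cond_var M s r v) *\<^sub>R resid M s r v"
proof -
  define z where "z = axis j 1 - obs_prec M s r (obs r (M v))"
  note z = obs_cov_fun_upd_column[where r = r, OF j, of v, folded z_def]
  have "obs_prec M s (r(j := v)) (axis j 1) = (1 / cond_var M s r v) *\<^sub>R z"
    using cond_var_pos[where r = r, OF j, of v]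
    by (intro obs_prec_eqI) (simp add: linear_scale[OF linear_obs_cov] z(1))
  then show ?thesis by (simp add: linear_scale[OF linear_obs_adj] z(2))
qed

text \<open>
  Adding a measurement changes the information operator \<open>O\<^sup>* \<Sigma>\<^sup>-\<^sup>1 O\<close> by a rank-one term along the
  residual, since only the part of the new datum that the old ones do not predict is informative.
\<close>
lemma information_fun_upd:
  fixes r :: "'m::finite \<Rightarrow> 'o"
  assumes j: "r j = 0"
  shows "obs_adj (r(j := v)) (obs_prec M s (r(j := v)) (obs (r(j := v)) u))
    = obs_adj r (obs_prec M s r (obs r u))
      + ((resid M s r v \<bullet> u) / cond_var M s r v) *\<^sub>R resid M s r v"
proof -
  define z where "z = axis j 1 - obs_prec M s r (obs r (M v))"
  note z = obs_cov_fun_upd_column[where r = r, OF j, of v, folded z_def]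
  define a where "a = obs_prec M s r (obs r u)"
  \<comment> \<open>The innovation of the new datum of \<open>u\<close>, in units of its conditional variance.\<close>
  define t where "t = (resid M s r v \<bullet> u) / cond_var M s r v"
  have aj: "a $ j = 0" unfolding a_def by (rule obs_prec_component_0) (rule j)
  have adj: "obs_adj (r(j := v)) a = obs_adj r a"
    by (simp add: obs_adj_fun_upd[of r, OF j] aj)
  have "obs_cov M s (r(j := v)) a = obs_cov M s r a + (v \<bullet> M (obs_adj r a)) *\<^sub>R axis j 1"
    unfolding obs_cov_def adj by (simp add: obs_fun_upd[of r, OF j])
  also have "obs_cov M s r a = obs r u" unfolding a_def by simp
  also have "v \<bullet> M (obs_adj r a) = v \<bullet> u - resid M s r v \<bullet> u"
    unfolding a_def resid_def
    by (simp add: inner_diff_left obs_adj_inner inner_obs_adj obs_prec_sym flip: sym_M)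
  finally have cov_a: "obs_cov M s (r(j := v)) a
      = obs r u + (v \<bullet> u - resid M s r v \<bullet> u) *\<^sub>R axis j 1" .
  have "obs_cov M s (r(j := v)) (a + t *\<^sub>R z) = obs (r(j := v)) u"
    using cond_var_pos[where r = r, OF j, of v]
    by (simp add: linear_add[OF linear_obs_cov] linear_scale[OF linear_obs_cov] cov_a z(1)
        obs_fun_upd[of r, OF j] t_def scaleR_diff_left)
  then have "obs_prec M s (r(j := v)) (obs (r(j := v)) u) = a + t *\<^sub>R z"
    by (rule obs_prec_eqI)
  then show ?thesis
    by (simp add: linear_add[OF linear_obs_adj] linear_scale[OF linear_obs_adj] adj z(2) flip: a_def t_def)
qed

end

section \<open>Signal and model error together\<close>

text \<open>
  Model error has covariance \<open>M\<close>. The signal is a standard Gaussian pushed through \<open>W'\<close>, so that the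
  whole field has covariance \<open>C = M + W' W\<close>. In the application \<open>W = \<Gamma>\<^sub>p\<^sup>1\<^sup>/\<^sup>2 F\<^sup>*\<close>.
\<close>
locale linear_gaussian_model = noisy_obs M s
  for M :: "'o::real_inner \<Rightarrow> 'o" and s :: real +
  fixes W :: "'o \<Rightarrow> 'p::real_inner" and W' :: "'p \<Rightarrow> 'o" and C :: "'o \<Rightarrow> 'o"
  assumes W_adj: "W x \<bullet> p = x \<bullet> W' p"
    and C_eq: "C x = M x + W' (W x)"
begin

lemma linear_W: "linear W"
  by (rule linear_if_inner_adjoint[of W']) (metis W_adj inner_commute)

lemma linear_W': "linear W'"
  by (rule linear_if_inner_adjoint[of W]) (rule W_adj)

sublocale C: noisy_obs C s
proof (rule noisy_obs.intro)
  show "linear C"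
    by (rule linearI)
      (simp_all add: C_eq linear_add[OF linear_M] linear_add[OF linear_W] linear_add[OF linear_W']
        linear_scale[OF linear_M] linear_scale[OF linear_W] linear_scale[OF linear_W'] scaleR_add_right)
  show "C x \<bullet> y = x \<bullet> C y" for x y
    unfolding C_eq inner_add_left inner_add_right sym_M by (metis W_adj inner_commute)
  show "0 \<le> x \<bullet> C x" for x
    unfolding C_eq inner_add_right using pos_M[of x] by (simp flip: W_adj)
qed (rule s_pos)

text \<open>The posterior precision of the whitened signal; its determinant is what the objective maximizes.\<close>
definition precond :: "('m::finite \<Rightarrow> 'o) \<Rightarrow> 'p \<Rightarrow> 'p" where
  "precond r v = v + W (obs_adj r (obs_prec M s r (obs r (W' v))))"

lemma linear_precond: "linear (precond r)"
  by (rule linearI)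
    (simp_all add: precond_def linear_add[OF linear_W] linear_add[OF linear_W']
      linear_add[OF linear_obs] linear_add[OF linear_obs_adj] linear_add[OF linear_obs_prec]
      linear_scale[OF linear_W] linear_scale[OF linear_W'] linear_scale[OF linear_obs]
      linear_scale[OF linear_obs_adj] linear_scale[OF linear_obs_prec] scaleR_add_right)

lemma obs_signal_resid:
  "obs r (W' (W (resid C s r v)))
    = obs_cov M s r (obs_prec C s r (obs r (C v))) - obs r (M v)"
proof -
  define y where "y = obs_prec C s r (obs r (C v))"
  have W'W: "W' (W x) = C x - M x" for x by (simp add: C_eq)
  have "obs r (W' (W (resid C s r v))) = obs r (C (resid C s r v)) - obs r (M (resid C s r v))"
    by (simp add: W'W linear_diff[OF linear_obs])
  also have "obs r (C (resid C s r v)) = s *\<^sub>R y" unfolding y_def by (rule C.obs_resid)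
  also have "obs r (M (resid C s r v)) = obs r (M v) - obs r (M (obs_adj r y))"
    by (simp add: resid_def y_def linear_diff[OF linear_M] linear_diff[OF linear_obs])
  finally show ?thesis by (simp add: obs_cov_def flip: y_def)
qed

text \<open>
  The posterior precision links the residuals under the two covariances. This solves, explicitly,
  the linear system that the matrix determinant lemma asks for.
\<close>
lemma precond_resid: "precond r (W (resid C s r v)) = W (resid M s r v)"
proof -
  have "obs_prec M s r (obs r (W' (W (resid C s r v))))
      = obs_prec C s r (obs r (C v)) - obs_prec M s r (obs r (M v))"
    by (rule obs_prec_eqI) (simp add: obs_signal_resid linear_diff[OF linear_obs_cov])
  then show ?thesis
    by (simp add: precond_def resid_def linear_diff[OF linear_obs_adj] linear_diff[OF linear_W])
qed

text \<open>The scalar that the matrix determinant lemma produces is the ratio of the two conditional variances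
  minus one; this is that statement cleared of its denominator.\<close>
lemma cond_var_diff:
  "cond_var C s r v = cond_var M s r v + W (resid M s r v) \<bullet> W (resid C s r v)"
proof -
  define y where "y = obs_prec C s r (obs r (C v))"
  define x where "x = obs_prec M s r (obs r (M v))"
  have rC: "resid C s r v = v - obs_adj r y" and rM: "resid M s r v = v - obs_adj r x"
    by (simp_all add: resid_def x_def y_def)
  have "W (resid M s r v) \<bullet> W (resid C s r v) = resid M s r v \<bullet> W' (W (resid C s r v))"
    by (rule W_adj)
  also have "\<dots> = v \<bullet> W' (W (resid C s r v)) - x \<bullet> obs r (W' (W (resid C s r v)))"
    unfolding rM inner_diff_left obs_adj_inner ..
  also have "x \<bullet> obs r (W' (W (resid C s r v))) = obs r (M v) \<bullet> y - x \<bullet> obs r (M v)"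
    unfolding obs_signal_resid inner_diff_right by (simp add: x_def flip: obs_cov_sym y_def)
  also have "obs r (M v) \<bullet> y = v \<bullet> M (obs_adj r y)"
    by (simp only: sym_M flip: inner_obs_adj)
  also have "x \<bullet> obs r (M v) = v \<bullet> M (obs_adj r x)"
    by (metis obs_adj_inner inner_commute[of v] sym_M)
  finally have "W (resid M s r v) \<bullet> W (resid C s r v)
      = v \<bullet> W' (W (resid C s r v)) - (v \<bullet> M (obs_adj r y) - v \<bullet> M (obs_adj r x))" .
  moreover have "cond_var C s r v
      = s + v \<bullet> M (resid C s r v) + v \<bullet> W' (W (resid C s r v))"
    unfolding cond_var_def C_eq[of "resid C s r v"] by (simp add: inner_add_right)
  moreover have "M (resid C s r v) = M v - M (obs_adj r y)"
    "M (resid M s r v) = M v - M (obs_adj r x)"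
    unfolding rC rM by (simp_all only: linear_diff[OF linear_M])
  ultimately show ?thesis unfolding cond_var_def by (simp add: inner_diff_right)
qed

end

section \<open>Determinants of compressions\<close>

text \<open>
  The bordered matrix with blocks \<open>1, - w\<^sup>t, x, I\<close> has a factorization that eliminates \<open>x\<close> from the
  left and one that eliminates it from the right; comparing determinants gives the formula.
\<close>
lemma det_one_plus_rank_one:
  fixes x w :: "nat \<Rightarrow> real"
  shows "Determinant.det (Matrix.mat n n (\<lambda>(i, j). (if i = j then 1 else 0) + x i * w j))
    = 1 + (\<Sum>i<n. w i * x i)"
proof -
  define X where "X = Matrix.mat n 1 (\<lambda>(i, j). x i)"
  define V where "V = Matrix.mat 1 n (\<lambda>(i, j). w j)"
  have X: "X \<in> carrier_mat n 1" and V: "V \<in> carrier_mat 1 n"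
    by (simp_all add: X_def V_def)
  have nV: "- V \<in> carrier_mat 1 n" using V by simp
  have XV: "1\<^sub>m n + X * V \<in> carrier_mat n n" using X V by simp
  have VX: "1\<^sub>m 1 + V * X \<in> carrier_mat 1 1" using X V by simp
  define E where "E = four_block_mat (1\<^sub>m 1) (- V) X (1\<^sub>m n)"
  define L where "L = four_block_mat (1\<^sub>m 1) (0\<^sub>m 1 n) X (1\<^sub>m n)"
  define U1 where "U1 = four_block_mat (1\<^sub>m 1) (- V) (0\<^sub>m n 1) (1\<^sub>m n + X * V)"
  define U2 where "U2 = four_block_mat (1\<^sub>m 1 + V * X) (- V) (0\<^sub>m n 1) (1\<^sub>m n)"
  have carrier: "L \<in> carrier_mat (1 + n) (1 + n)" "U1 \<in> carrier_mat (1 + n) (1 + n)"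
    "U2 \<in> carrier_mat (1 + n) (1 + n)"
    unfolding L_def U1_def U2_def
    by (rule four_block_carrier_mat; use X V XV VX in simp)+
  have "Determinant.det L = 1"
    unfolding L_def by (subst det_four_block_mat_upper_right_zero[OF _ refl X]) simp_all
  moreover have "Determinant.det U1 = Determinant.det (1\<^sub>m n + X * V)"
    unfolding U1_def by (subst det_four_block_mat_lower_left_zero[OF _ nV refl XV]) simp_all
  moreover have "Determinant.det U2 = Determinant.det (1\<^sub>m 1 + V * X)"
    unfolding U2_def by (subst det_four_block_mat_lower_left_zero[OF VX nV refl]) simp_all
  moreover have "L * U1 = E"
  proof -
    have XnV: "X * - V = - (X * V)" using X V by simp
    show ?thesis
      unfolding L_def U1_def E_def
        mult_four_block_mat[OF one_carrier_mat zero_carrier_mat X one_carrier_mat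
          one_carrier_mat nV zero_carrier_mat XV]
      by (rule cong_four_block_mat) (use X V XV in \<open>auto simp: XnV intro!: eq_matI\<close>)
  qed
  moreover have "U2 * L = E"
  proof -
    have nVX: "- V * X = - (V * X)" using X V by simp
    show ?thesis
      unfolding L_def U2_def E_def
        mult_four_block_mat[OF VX nV zero_carrier_mat one_carrier_mat
          one_carrier_mat zero_carrier_mat X one_carrier_mat]
      by (rule cong_four_block_mat) (use X V VX in \<open>auto simp: nVX intro!: eq_matI\<close>)
  qed
  ultimately have "Determinant.det (1\<^sub>m n + X * V) = Determinant.det (1\<^sub>m 1 + V * X)"
    using det_mult[OF carrier(1,2)] det_mult[OF carrier(3,1)] by simp
  moreover have "1\<^sub>m n + X * V = Matrix.mat n n (\<lambda>(i, j). (if i = j then 1 else 0) + x i * w j)"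
    by (rule eq_matI) (auto simp: X_def V_def scalar_prod_def)
  moreover have "Determinant.det (1\<^sub>m 1 + V * X) = 1 + (\<Sum>i<n. w i * x i)"
    by (subst det_single) (auto simp: X_def V_def scalar_prod_def atLeast0LessThan)
  ultimately show ?thesis by simp
qed

definition orthonormal_list :: "'a::real_inner list \<Rightarrow> bool" where
  "orthonormal_list es \<longleftrightarrow>
     (\<forall>i < length es. \<forall>j < length es. es ! i \<bullet> es ! j = (if i = j then 1 else 0))"

definition compression_det :: "'a::real_inner list \<Rightarrow> ('a \<Rightarrow> 'a) \<Rightarrow> real" where
  "compression_det es T =
     Determinant.det (Matrix.mat (length es) (length es) (\<lambda>(i, j). es ! i \<bullet> T (es ! j)))"

lemma compression_det_id: "orthonormal_list es \<Longrightarrow> compression_det es (\<lambda>v. v) = 1"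
proof -
  assume "orthonormal_list es"
  then have "Matrix.mat (length es) (length es) (\<lambda>(i, j). es ! i \<bullet> es ! j) = 1\<^sub>m (length es)"
    by (intro eq_matI) (auto simp: orthonormal_list_def)
  then show ?thesis by (simp add: compression_det_def)
qed

lemma orthonormal_expansion:
  assumes on: "orthonormal_list es" and x: "x \<in> span (set es)"
  shows "x = (\<Sum>k<length es. (es ! k \<bullet> x) *\<^sub>R es ! k)"
  using x
proof (induction rule: span_induct_alt)
  case base show ?case by simp
next
  case (step c e y)
  from step(1) obtain i where i: "i < length es" "e = es ! i" by (auto simp: in_set_conv_nth)
  have e_sum: "(\<Sum>k<length es. (es ! k \<bullet> e) *\<^sub>R es ! k) = e"
  proof -
    have "(\<Sum>k<length es. (es ! k \<bullet> e) *\<^sub>R es ! k) = (\<Sum>k<length es. if k = i then es ! i else 0)"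
      using on i by (intro sum.cong) (auto simp: orthonormal_list_def)
    then show ?thesis using i by simp
  qed
  have "(\<Sum>k<length es. (es ! k \<bullet> (c *\<^sub>R e + y)) *\<^sub>R es ! k)
      = c *\<^sub>R (\<Sum>k<length es. (es ! k \<bullet> e) *\<^sub>R es ! k)
        + (\<Sum>k<length es. (es ! k \<bullet> y) *\<^sub>R es ! k)"
    by (simp add: inner_add_right scaleR_add_left sum.distrib scaleR_sum_right)
  then show ?case unfolding e_sum step(2)[symmetric] by (rule sym)
qed

lemma projection_residual_orthogonal:
  assumes on: "orthonormal_list es" and i: "i < length es"
  shows "es ! i \<bullet> (y - (\<Sum>k<length es. (es ! k \<bullet> y) *\<^sub>R es ! k)) = 0"
proof -
  have "es ! i \<bullet> (\<Sum>k<length es. (es ! k \<bullet> y) *\<^sub>R es ! k)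
      = (\<Sum>k<length es. if k = i then es ! i \<bullet> y else 0)"
    using on i unfolding inner_sum_right
    by (intro sum.cong) (auto simp: orthonormal_list_def)
  then show ?thesis using i by (simp add: inner_diff_right)
qed

lemma orthonormal_list_spanning:
  fixes B :: "'a::real_inner set"
  assumes "finite B"
  shows "\<exists>es. orthonormal_list es \<and> B \<subseteq> span (set es)"
  using assms
proof (induction B)
  case empty show ?case by (rule exI[of _ "[]"]) (simp add: orthonormal_list_def)
next
  case (insert a B)
  then obtain es where on: "orthonormal_list es" and B: "B \<subseteq> span (set es)" by blast
  define p where "p = (\<Sum>k<length es. (es ! k \<bullet> a) *\<^sub>R es ! k)"
  define d where "d = a - p"
  have p: "p \<in> span (set es)"
    unfolding p_def by (intro span_sum span_scale span_base) simp
  show ?case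
  proof (cases "d = 0")
    case True
    then have "a \<in> span (set es)" using p by (simp add: d_def)
    with on B show ?thesis by blast
  next
    case False
    define e where "e = (1 / norm d) *\<^sub>R d"
    have orth: "es ! i \<bullet> e = 0" if "i < length es" for i
      using projection_residual_orthogonal[OF on that, of a] by (simp add: e_def d_def p_def)
    then have orth': "e \<bullet> es ! i = 0" if "i < length es" for i
      using that by (simp add: inner_commute)
    have ee: "e \<bullet> e = 1"
      using False by (simp add: e_def dot_square_norm power2_eq_square)
    have "orthonormal_list (es @ [e])"
      using on orth orth' ee
      by (auto simp: orthonormal_list_def nth_append less_Suc_eq)
    moreover have "insert a B \<subseteq> span (set (es @ [e]))"
    proof -
      have mono: "span (set es) \<subseteq> span (set (es @ [e]))" by (rule span_mono) auto
      have "a = p + norm d *\<^sub>R e" using False by (simp add: e_def d_def)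
      also have "\<dots> \<in> span (set (es @ [e]))"
        using p mono by (intro span_add span_scale) (auto intro: span_base)
      finally show ?thesis using B mono by blast
    qed
    ultimately show ?thesis by blast
  qed
qed

text \<open>
  The matrix determinant lemma, with \<open>x\<close> in place of \<open>T\<^sup>-\<^sup>1 u\<close>: the updated matrix is the old one
  times \<open>I + c x u\<^sup>t\<close>.
\<close>
lemma compression_det_rank_one_update:
  assumes on: "orthonormal_list es" and T: "linear T"
    and x: "x \<in> span (set es)" and Tx: "T x = u"
  shows "compression_det es (\<lambda>v. T v + (c * (u \<bullet> v)) *\<^sub>R u)
    = compression_det es T * (1 + c * (u \<bullet> x))"
proof -
  let ?n = "length es"
  define A where "A = Matrix.mat ?n ?n (\<lambda>(i, j). es ! i \<bullet> T (es ! j))"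
  define R where "R = Matrix.mat ?n ?n
    (\<lambda>(i, j). (if i = j then 1 else 0) + (es ! i \<bullet> x) * (c * (u \<bullet> es ! j)))"
  have u_coord: "(\<Sum>k<?n. (e \<bullet> T (es ! k)) * (es ! k \<bullet> x)) = e \<bullet> u" for e
  proof -
    have "u = T (\<Sum>k<?n. (es ! k \<bullet> x) *\<^sub>R es ! k)"
      using orthonormal_expansion[OF on x] Tx by simp
    then show ?thesis
      by (simp add: linear_sum[OF T] linear_scale[OF T] inner_sum_right mult.commute)
  qed
  have "Matrix.mat ?n ?n (\<lambda>(i, j). es ! i \<bullet> (T (es ! j) + (c * (u \<bullet> es ! j)) *\<^sub>R u)) = A * R"
  proof (rule eq_matI)
    fix i j assume "i < dim_row (A * R)" "j < dim_col (A * R)"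
    then have i: "i < ?n" and j: "j < ?n" by (simp_all add: A_def R_def)
    have "(A * R) $$ (i, j) = (\<Sum>k<?n. (es ! i \<bullet> T (es ! k)) *
        ((if k = j then 1 else 0) + (es ! k \<bullet> x) * (c * (u \<bullet> es ! j))))"
      using i j by (simp add: A_def R_def scalar_prod_def atLeast0LessThan)
    also have "\<dots> = (\<Sum>k<?n. if k = j then es ! i \<bullet> T (es ! j) else 0)
        + (\<Sum>k<?n. (es ! i \<bullet> T (es ! k)) * (es ! k \<bullet> x)) * (c * (u \<bullet> es ! j))"
      unfolding sum_distrib_right sum.distrib[symmetric]
      by (rule sum.cong) (auto simp: algebra_simps)
    also have "\<dots> = es ! i \<bullet> T (es ! j) + (es ! i \<bullet> u) * (c * (u \<bullet> es ! j))"
      unfolding u_coord using j by simp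
    finally show "Matrix.mat ?n ?n (\<lambda>(i, j). es ! i \<bullet> (T (es ! j) + (c * (u \<bullet> es ! j)) *\<^sub>R u)) $$ (i, j)
        = (A * R) $$ (i, j)"
      using i j by (simp add: inner_add_right mult_ac)
  qed (simp_all add: A_def R_def)
  then have "compression_det es (\<lambda>v. T v + (c * (u \<bullet> v)) *\<^sub>R u)
      = Determinant.det A * Determinant.det R"
    unfolding compression_det_def by (simp add: det_mult[where n = ?n] A_def R_def)
  also have "Determinant.det R = 1 + (\<Sum>k<?n. c * (u \<bullet> es ! k) * (es ! k \<bullet> x))"
    unfolding R_def by (rule det_one_plus_rank_one)
  also have "(\<Sum>k<?n. c * (u \<bullet> es ! k) * (es ! k \<bullet> x))
      = c * (u \<bullet> (\<Sum>k<?n. (es ! k \<bullet> x) *\<^sub>R es ! k))"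
    by (simp add: inner_sum_right sum_distrib_left mult_ac)
  also have "\<dots> = c * (u \<bullet> x)" using orthonormal_expansion[OF on x] by simp
  finally show ?thesis by (simp add: A_def compression_det_def)
qed

section \<open>The chain rule for the information gain\<close>

context linear_gaussian_model
begin

definition signal_frame :: "('m::finite \<Rightarrow> 'o) \<Rightarrow> 'p list \<Rightarrow> bool" where
  "signal_frame r es \<longleftrightarrow> orthonormal_list es \<and> (\<forall>k. W (r k) \<in> span (set es))"

lemma W_obs_adj_in_span:
  assumes "signal_frame r es" shows "W (obs_adj r a) \<in> span (set es)"
  using assms unfolding signal_frame_def obs_adj_def linear_sum[OF linear_W] linear_scale[OF linear_W]
  by (intro span_sum span_scale) auto

lemma signal_frame_exists: "\<exists>es. signal_frame (r :: 'm::finite \<Rightarrow> 'o) es"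
  using orthonormal_list_spanning[of "range (\<lambda>k. W (r k))"] unfolding signal_frame_def by auto

text \<open>
  The right-hand side is the condition under which the operator determinant admits a list. It makes
  the list span \<open>W (r k)\<close>: the residual \<open>d\<close> of \<open>W (r k)\<close> after projection is orthogonal to the
  range of the finite-rank part of \<open>precond r\<close>, so the quadratic form of that part vanishes at \<open>d\<close>.
  As the precision of the data is definite, \<open>d\<close> is orthogonal to \<open>W (r k)\<close>, hence to itself.
\<close>
lemma signal_frame_iff:
  fixes r :: "'m::finite \<Rightarrow> 'o"
  shows "signal_frame r es \<longleftrightarrow>
    orthonormal_list es \<and> range (\<lambda>v. precond r v - v) \<subseteq> span (set es)"
proof
  assume "signal_frame r es"
  then show "orthonormal_list es \<and> range (\<lambda>v. precond r v - v) \<subseteq> span (set es)"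
    using W_obs_adj_in_span[of r es] by (auto simp: precond_def signal_frame_def)
next
  assume asm: "orthonormal_list es \<and> range (\<lambda>v. precond r v - v) \<subseteq> span (set es)"
  then have on: "orthonormal_list es" by blast
  have "W (r k) \<in> span (set es)" for k
  proof -
    define p where "p = (\<Sum>i<length es. (es ! i \<bullet> W (r k)) *\<^sub>R es ! i)"
    define d where "d = W (r k) - p"
    have p: "p \<in> span (set es)"
      unfolding p_def by (intro span_sum span_scale span_base) simp
    have "orthogonal d e" if "e \<in> set es" for e
      using projection_residual_orthogonal[OF on, of _ "W (r k)"] that
      by (auto simp: orthogonal_def d_def p_def in_set_conv_nth inner_commute)
    then have perp: "d \<bullet> y = 0" if "y \<in> span (set es)" for y
      using orthogonal_to_span[OF that] by (simp add: orthogonal_def)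
    have "precond r d - d \<in> span (set es)" using asm by blast
    then have "d \<bullet> W (obs_adj r (obs_prec M s r (obs r (W' d)))) = 0"
      using perp by (simp add: precond_def)
    then have "W (obs_adj r (obs_prec M s r (obs r (W' d)))) \<bullet> d = 0"
      by (simp only: inner_commute)
    then have "obs_prec M s r (obs r (W' d)) \<bullet> obs r (W' d) = 0"
      by (simp only: W_adj obs_adj_inner)
    then have "obs r (W' d) \<bullet> obs_prec M s r (obs r (W' d)) = 0"
      by (simp only: inner_commute)
    then have "obs r (W' d) = 0" by (rule obs_prec_inner_eq_0)
    then have "W (r k) \<bullet> d = 0" by (simp add: W_adj obs_def vec_eq_iff)
    then have "d \<bullet> d = 0" using perp[OF p] by (simp add: d_def inner_diff_right inner_commute)
    then show ?thesis using p by (simp add: d_def)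
  qed
  with on show "signal_frame r es" by (simp add: signal_frame_def)
qed

lemma precond_fun_upd:
  fixes r :: "'m::finite \<Rightarrow> 'o"
  assumes j: "r j = 0"
  shows "precond (r(j := v)) p = precond r p
    + (1 / cond_var M s r v * (W (resid M s r v) \<bullet> p)) *\<^sub>R W (resid M s r v)"
  unfolding precond_def information_fun_upd[where r = r, OF j]
  by (simp add: linear_add[OF linear_W] linear_scale[OF linear_W] W_adj)

text \<open>The chain rule, for the determinant in a fixed orthonormal list. The factor is free of the list.\<close>
lemma compression_det_precond_fun_upd:
  fixes r :: "'m::finite \<Rightarrow> 'o"
  assumes j: "r j = 0" and frame: "signal_frame (r(j := v)) es"
  shows "compression_det es (precond (r(j := v)))
    = compression_det es (precond r) * (cond_var C s r v / cond_var M s r v)"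
    and "signal_frame r es"
proof -
  have on: "orthonormal_list es" and Wv: "W v \<in> span (set es)"
    and Wr: "\<And>k. k \<noteq> j \<Longrightarrow> W (r k) \<in> span (set es)"
    using frame unfolding signal_frame_def by (auto split: if_splits)
  have "W (r k) \<in> span (set es)" for k
    using Wr[of k] by (cases "k = j") (simp_all add: j linear_0[OF linear_W] span_zero)
  then show frame0: "signal_frame r es" using on by (simp add: signal_frame_def)
  have span: "W (resid C s r v) \<in> span (set es)"
    unfolding resid_def linear_diff[OF linear_W]
    by (intro span_diff Wv W_obs_adj_in_span frame0)
  have upd: "precond (r(j := v)) = (\<lambda>p. precond r p
    + (1 / cond_var M s r v * (W (resid M s r v) \<bullet> p)) *\<^sub>R W (resid M s r v))"
    by (rule ext) (rule precond_fun_upd[where r = r, OF j])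
  have "compression_det es (precond (r(j := v))) = compression_det es (precond r)
      * (1 + 1 / cond_var M s r v * (W (resid M s r v) \<bullet> W (resid C s r v)))"
    unfolding upd by (rule compression_det_rank_one_update[OF on linear_precond span precond_resid])
  also have "1 + 1 / cond_var M s r v * (W (resid M s r v) \<bullet> W (resid C s r v))
      = cond_var C s r v / cond_var M s r v"
    using cond_var_pos[where r = r, OF j, of v]
    by (simp add: cond_var_diff field_simps)
  finally show "compression_det es (precond (r(j := v)))
    = compression_det es (precond r) * (cond_var C s r v / cond_var M s r v)" .
qed

text \<open>
  Induction on the set of measurements that are present. Without any, the operator is the
  identity; each one contributes a positive factor that is the same for both lists.
\<close>
lemma compression_det_precond_unique_pos:
  fixes r :: "'m::finite \<Rightarrow> 'o"
  assumes "signal_frame r es" "signal_frame r es'"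
  shows "compression_det es (precond r) = compression_det es' (precond r)
    \<and> 0 < compression_det es (precond r)"
proof -
  have "compression_det es (precond r) = compression_det es' (precond r)
      \<and> 0 < compression_det es (precond r)"
    if "finite J" "\<And>k. k \<notin> J \<Longrightarrow> r k = 0" "signal_frame r es" "signal_frame r es'"
    for J and r :: "'m \<Rightarrow> 'o"
    using that
  proof (induction J arbitrary: r)
    case empty
    then have "r = (\<lambda>k. 0)" by auto
    then have id: "precond r = (\<lambda>v. v)"
      by (auto simp: precond_def obs_adj_def linear_0[OF linear_W])
    have "orthonormal_list es" "orthonormal_list es'"
      using empty.prems(2,3) by (simp_all only: signal_frame_def)
    then show ?case unfolding id by (simp add: compression_det_id)
  next
    case (insert j J)
    define r0 v where "r0 = r(j := 0)" and "v = r j"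
    have r0: "r0 j = 0" "r = r0(j := v)" by (simp_all add: r0_def v_def)
    have "r0 k = 0" if "k \<notin> J" for k using insert.prems(1)[of k] that by (auto simp: r0_def)
    moreover note step =
      compression_det_precond_fun_upd[where r = r0, OF r0(1) insert.prems(2)[unfolded r0(2)]]
      compression_det_precond_fun_upd[where r = r0, OF r0(1) insert.prems(3)[unfolded r0(2)]]
    ultimately have "compression_det es (precond r0) = compression_det es' (precond r0)
        \<and> 0 < compression_det es (precond r0)"
      using insert.IH[of r0] by blast
    moreover have "0 < cond_var C s r0 v / cond_var M s r0 v"
      using cond_var_pos[where r = r0, OF r0(1)] C.cond_var_pos[where r = r0, OF r0(1)] by simp
    ultimately show ?case unfolding r0(2) step(1,3) by (metis mult_pos_pos)
  qed
  from this[of UNIV r] assms show ?thesis by simp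
qed

lemma op_det_precond:
  fixes r :: "'m::finite \<Rightarrow> 'o"
  assumes frame: "signal_frame r es"
  shows "op_det (precond r) = compression_det es (precond r)"
  unfolding op_det_def orthonormal_list_def[symmetric] compression_det_def[symmetric]
proof (rule the_equality)
  show "\<exists>es'. orthonormal_list es' \<and> range (\<lambda>x. precond r x - x) \<subseteq> span (set es') \<and>
      compression_det es (precond r) = compression_det es' (precond r)"
    using frame[unfolded signal_frame_iff] by blast
next
  fix d
  assume "\<exists>es'. orthonormal_list es' \<and> range (\<lambda>x. precond r x - x) \<subseteq> span (set es') \<and>
      d = compression_det es' (precond r)"
  then obtain es' where "signal_frame r es'" "d = compression_det es' (precond r)"
    unfolding signal_frame_iff by blast
  then show "d = compression_det es (precond r)"
    using compression_det_precond_unique_pos[OF frame] by simp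
qed

lemma op_det_precond_pos: "0 < op_det (precond (r :: 'm::finite \<Rightarrow> 'o))"
proof -
  obtain es where frame: "signal_frame r es" using signal_frame_exists by blast
  then show ?thesis
    using compression_det_precond_unique_pos[OF frame frame] op_det_precond[OF frame] by simp
qed

lemma op_det_precond_fun_upd:
  fixes r :: "'m::finite \<Rightarrow> 'o"
  assumes j: "r j = 0"
  shows "op_det (precond (r(j := v)))
    = op_det (precond r) * (cond_var C s r v / cond_var M s r v)"
proof -
  obtain es where frame: "signal_frame (r(j := v)) es" using signal_frame_exists by blast
  note step = compression_det_precond_fun_upd[where r = r, OF j frame]
  show ?thesis
    unfolding op_det_precond[OF frame] op_det_precond[OF step(2)] by (rule step(1))
qed

end

section \<open>Stationarity of an optimal design\<close>

lemma linear_combination_axis: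
  fixes a :: "real ^ 'm::finite"
  assumes "linear f"
  shows "f a = (\<Sum>k\<in>UNIV. (a $ k) *\<^sub>R f (axis k 1))"
proof -
  have "a = (\<Sum>k\<in>UNIV. (a $ k) *\<^sub>R axis k 1)"
    using basis_expansion[of a] by (simp add: scalar_mult_eq_scaleR)
  then have "f a = f (\<Sum>k\<in>UNIV. (a $ k) *\<^sub>R axis k 1)" by simp
  then show ?thesis by (simp add: linear_sum[OF assms] linear_scale[OF assms])
qed

context linear_gaussian_model
begin

text \<open>
  Let \<open>p\<close> and \<open>q\<close> be the variances under \<open>C\<close> and \<open>M\<close> at the maximizer \<open>v\<close>, and let primes denote
  conditional covariances. Maximality says that the form of \<open>Z = p (s I + M') - q (s I + C')\<close> is
  nonnegative, first on the unit sphere and then everywhere by homogeneity. It vanishes at \<open>v\<close>, so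
  \<open>Z v = 0\<close> by the Cauchy-Schwarz inequality.
\<close>
lemma maximal_variance_ratio_stationary:
  fixes r :: "'m::finite \<Rightarrow> 'o"
  assumes j: "r j = 0" and v: "norm v = 1"
    and max: "\<And>u. norm u = 1 \<Longrightarrow>
      cond_var C s r u / cond_var M s r u \<le> cond_var C s r v / cond_var M s r v"
  shows "(1 / cond_var C s r v) *\<^sub>R C (resid C s r v) - (1 / cond_var M s r v) *\<^sub>R M (resid M s r v)
    = (s * (1 / cond_var M s r v - 1 / cond_var C s r v)) *\<^sub>R v"
proof -
  define p q where "p = cond_var C s r v" and "q = cond_var M s r v"
  have p: "p > 0" and q: "q > 0"
    unfolding p_def q_def using C.cond_var_pos[where r = r, OF j] cond_var_pos[where r = r, OF j] by auto
  define Z where "Z x = p *\<^sub>R (s *\<^sub>R x + M (resid M s r x)) - q *\<^sub>R (s *\<^sub>R x + C (resid C s r x))" for x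
  have linZ: "linear Z"
    unfolding Z_def
    by (rule linearI)
      (simp_all add: linear_add[OF linear_M] linear_add[OF C.linear_M] linear_add[OF linear_resid]
        linear_add[OF C.linear_resid] linear_scale[OF linear_M] linear_scale[OF C.linear_M]
        linear_scale[OF linear_resid] linear_scale[OF C.linear_resid] algebra_simps)
  have symZ: "Z x \<bullet> y = x \<bullet> Z y" for x y
    unfolding Z_def
    by (simp add: inner_diff_left inner_diff_right inner_add_left inner_add_right resid_sym C.resid_sym)
  have Z_unit: "u \<bullet> Z u = p * cond_var M s r u - q * cond_var C s r u" if "norm u = 1" for u
    using that unfolding Z_def cond_var_def
    by (simp add: inner_diff_right inner_add_right dot_square_norm)
  have posZ: "0 \<le> x \<bullet> Z x" for x
  proof (cases "x = 0")
    case False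
    define u where "u = (1 / norm x) *\<^sub>R x"
    have u: "norm u = 1" "x = norm x *\<^sub>R u" using False by (simp_all add: u_def)
    have "cond_var C s r u / cond_var M s r u \<le> p / q"
      unfolding p_def q_def by (rule max[OF u(1)])
    then have "0 \<le> u \<bullet> Z u"
      using Z_unit[OF u(1)] q cond_var_pos[where r = r, OF j, of u] by (simp add: field_simps)
    moreover have "x \<bullet> Z x = (norm x)\<^sup>2 * (u \<bullet> Z u)"
      using arg_cong2[OF u(2) u(2), of "\<lambda>a b. a \<bullet> Z b"]
      by (simp add: linear_scale[OF linZ] power2_eq_square)
    ultimately show ?thesis by simp
  qed simp
  have "v \<bullet> Z v = 0" using Z_unit[OF v] by (simp add: p_def q_def)
  then have "(Z v \<bullet> Z v)\<^sup>2 \<le> 0"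
    using semidefinite_Cauchy_Schwarz[OF linZ symZ posZ, of "Z v" v] by simp
  then have "Z v = 0" by simp
  then have "(1 / (p * q)) *\<^sub>R Z v = 0" by simp
  moreover have "(1 / (p * q)) *\<^sub>R Z v = (s * (1 / q - 1 / p)) *\<^sub>R v
      + (1 / q) *\<^sub>R M (resid M s r v) - (1 / p) *\<^sub>R C (resid C s r v)"
    using p q unfolding Z_def by (simp add: algebra_simps)
  ultimately show ?thesis unfolding p_def q_def by (simp add: algebra_simps)
qed

text \<open>
  For each index \<open>j\<close>, the stationarity of the variance ratio is the claim for the \<open>j\<close>-th unit vector;
  linearity gives the rest.
\<close>
lemma optimal_design_stationary:
  fixes r :: "'m::finite \<Rightarrow> 'o"
  assumes unit: "\<And>k. norm (r k) = 1"
    and opt: "\<And>j v. norm v = 1 \<Longrightarrow> op_det (precond (r(j := v))) \<le> op_det (precond r)"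
  obtains \<xi> :: "'m \<Rightarrow> real" where
    "\<And>a. C (obs_adj r (obs_prec C s r a)) - M (obs_adj r (obs_prec M s r a))
      = obs_adj r (\<chi> k. \<xi> k * a $ k)"
proof -
  have "\<exists>\<xi>. C (obs_adj r (obs_prec C s r (axis j 1))) - M (obs_adj r (obs_prec M s r (axis j 1)))
      = \<xi> *\<^sub>R r j" for j
  proof -
    define r0 v where "r0 = r(j := 0)" and "v = r j"
    have r0: "r0 j = 0" and r: "r = r0(j := v)" by (simp_all add: r0_def v_def)
    have ratio: "cond_var C s r0 u / cond_var M s r0 u \<le> cond_var C s r0 v / cond_var M s r0 v"
      if "norm u = 1" for u
    proof -
      have upd: "r(j := u) = r0(j := u)" by (simp add: r0_def)
      have "op_det (precond (r0(j := u))) \<le> op_det (precond (r0(j := v)))"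
        using opt[OF that, of j] unfolding upd unfolding r[symmetric] .
      then show ?thesis
        unfolding op_det_precond_fun_upd[where r = r0, OF r0]
        using op_det_precond_pos[of r0] by (simp only: mult_le_cancel_left_pos)
    qed
    have "norm v = 1" by (simp add: v_def unit)
    note stat = maximal_variance_ratio_stationary[where r = r0, OF r0 this ratio]
    show ?thesis
      unfolding r obs_adj_prec_axis[where r = r0, OF r0] C.obs_adj_prec_axis[where r = r0, OF r0]
        linear_scale[OF linear_M] linear_scale[OF C.linear_M]
      by (rule exI, subst fun_upd_same, rule stat)
  qed
  then have "\<exists>\<xi>. \<forall>j. C (obs_adj r (obs_prec C s r (axis j 1)))
      - M (obs_adj r (obs_prec M s r (axis j 1))) = \<xi> j *\<^sub>R r j" by (intro choice) blast
  then obtain \<xi> where \<xi>: "\<And>j. C (obs_adj r (obs_prec C s r (axis j 1)))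
      - M (obs_adj r (obs_prec M s r (axis j 1))) = \<xi> j *\<^sub>R r j" by blast
  define f where "f a = C (obs_adj r (obs_prec C s r a)) - M (obs_adj r (obs_prec M s r a))" for a
  have f_axis: "f (axis j 1) = \<xi> j *\<^sub>R r j" for j unfolding f_def by (rule \<xi>)
  have "linear f"
    unfolding f_def
    by (rule linearI)
      (simp_all add: linear_add[OF linear_M] linear_add[OF C.linear_M] linear_add[OF linear_obs_adj]
        linear_add[OF linear_obs_prec] linear_add[OF C.linear_obs_prec]
        linear_scale[OF linear_M] linear_scale[OF C.linear_M] linear_scale[OF linear_obs_adj]
        linear_scale[OF linear_obs_prec] linear_scale[OF C.linear_obs_prec] algebra_simps)
  have "f a = obs_adj r (\<chi> k. \<xi> k * a $ k)" for a
    unfolding linear_combination_axis[OF \<open>linear f\<close>, of a] f_axis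
    by (simp add: obs_adj_def mult.commute)
  then show ?thesis using that unfolding f_def by blast
qed

text \<open>The identity \<open>\<Sigma>\<^sup>-\<^sup>1 (P - \<Sigma>) P\<^sup>-\<^sup>1 = \<Sigma>\<^sup>-\<^sup>1 - P\<^sup>-\<^sup>1\<close>, where \<open>P\<close> is the data covariance of \<open>C\<close>.\<close>
lemma signal_gain:
  "obs_prec M s r (obs r (W' (W (obs_adj r (obs_prec C s r a))))) = obs_prec M s r a - obs_prec C s r a"
proof (rule obs_prec_eqI)
  define y where "y = obs_prec C s r a"
  have a: "a = obs r (C (obs_adj r y)) + s *\<^sub>R y"
    using C.obs_cov_prec[of r a] by (simp only: obs_cov_def y_def)
  have "obs_cov M s r (obs_prec M s r a - y) = a - obs_cov M s r y"
    by (simp add: linear_diff[OF linear_obs_cov])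
  also have "\<dots> = obs r (C (obs_adj r y)) - obs r (M (obs_adj r y))"
    by (subst a) (simp add: obs_cov_def)
  also have "\<dots> = obs r (W' (W (obs_adj r y)))"
    by (simp add: C_eq linear_add[OF linear_obs])
  finally show "obs_cov M s r (obs_prec M s r a - obs_prec C s r a)
      = obs r (W' (W (obs_adj r (obs_prec C s r a))))"
    unfolding y_def .
qed

end

section \<open>The design problem\<close>

lemma norm_blinfun_inner:
  fixes f :: "'a::real_inner \<Rightarrow>\<^sub>L real"
  assumes "\<And>u. blinfun_apply f u = r \<bullet> u"
  shows "norm f = norm r"
proof (rule antisym)
  show "norm f \<le> norm r"
    by (rule norm_blinfun_bound) (simp_all add: assms Cauchy_Schwarz_ineq2)
  have "norm r * norm r \<le> norm f * norm r"
    using norm_blinfun[of f r] by (simp add: assms dot_square_norm power2_eq_square)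
  then show "norm r \<le> norm f"
    by (cases "r = 0") simp_all
qed

lemma adjoint_obs: "adjoint (obs r) = obs_adj r"
  by (rule adjoint_unique) (simp add: inner_obs_adj)

lemma meas_op_eq_obs:
  assumes "\<And>k u. blinfun_apply (D $ k) u = r k \<bullet> u"
  shows "meas_op D = obs r" and "noise_cov M \<sigma> D = obs_cov M (\<sigma>\<^sup>2) r"
proof -
  show op: "meas_op D = obs r" by (simp add: fun_eq_iff meas_op_def obs_def assms)
  show "noise_cov M \<sigma> D = obs_cov M (\<sigma>\<^sup>2) r"
    by (rule ext) (simp only: noise_cov_def obs_cov_def op adjoint_obs)
qed

lemma misfit_hessian_eq_obs:
  assumes "\<And>k u. blinfun_apply (D $ k) u = r k \<bullet> u"
  shows "misfit_hessian F M \<sigma> D p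
    = adjoint F (obs_adj r (obs_prec M (\<sigma>\<^sup>2) r (obs r (F p))))"
  unfolding misfit_hessian_def meas_op_eq_obs[of D r, OF assms] adjoint_obs
  by (simp add: obs_prec_def)

text \<open>
  The operator \<open>\<Gamma>\<^sup>-\<^sup>1 + H\<close> is injective on the range of \<open>\<Gamma>\<close>: if \<open>d + H \<Gamma> d = 0\<close>, pairing with \<open>\<Gamma> d\<close> gives
  \<open>\<langle>d, \<Gamma> d\<rangle> \<le> 0\<close>. So a preimage exhibited in that range is the posterior covariance applied to \<open>b\<close>.
\<close>
lemma post_cov_eqI:
  fixes F :: "'p::{real_inner, complete_space} \<Rightarrow> 'o::real_inner"
  assumes F: "bounded_linear F" and cov: "covariance_operator \<Gamma>" and pd: "positive_definite \<Gamma>"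
    and N: "noisy_obs M (\<sigma>\<^sup>2)"
    and D: "\<And>k u. blinfun_apply (D $ k) u = r k \<bullet> u"
    and b: "w + misfit_hessian F M \<sigma> D (\<Gamma> w) = b"
  shows "post_cov \<Gamma> F M \<sigma> D b = \<Gamma> w"
proof -
  interpret N: noisy_obs M "\<sigma>\<^sup>2" by (rule N)
  define H where "H = misfit_hessian F M \<sigma> D"
  have H: "H p = adjoint F (obs_adj r (obs_prec M (\<sigma>\<^sup>2) r (obs r (F p))))" for p
    unfolding H_def by (rule misfit_hessian_eq_obs[OF D])
  have lin: "linear \<Gamma>"
    using cov unfolding covariance_operator_def by (auto dest: bounded_linear.linear)
  have linF: "linear F" using F by (rule bounded_linear.linear)
  have lin_adj: "linear (adjoint F)"
    by (rule linear_if_inner_adjoint[of F]) (rule inner_adjoint[OF F])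
  have H_diff: "H (x - y) = H x - H y" for x y
    unfolding H by (simp only: linear_diff[OF linF] linear_diff[OF linear_obs]
      linear_diff[OF N.linear_obs_prec] linear_diff[OF linear_obs_adj] linear_diff[OF lin_adj])
  have H_pos: "0 \<le> x \<bullet> H x" for x
    unfolding H by (simp only: inner_adjoint[OF F, symmetric] inner_obs_adj N.obs_prec_pos)
  have inj: "inj \<Gamma>"
  proof (rule linear_injective_0[OF lin, THEN iffD2], intro allI impI)
    fix x assume "\<Gamma> x = 0"
    then have "\<not> 0 < x \<bullet> \<Gamma> x" by simp
    then show "x = 0" using pd unfolding positive_definite_def by blast
  qed
  define h where "h u = inv_into UNIV \<Gamma> u + H u" for u
  have h: "h (\<Gamma> x) = x + H (\<Gamma> x)" for x by (simp add: h_def inv_f_f[OF inj])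
  have "inj_on h (range \<Gamma>)"
  proof (rule inj_onI, clarify)
    fix x y assume "h (\<Gamma> x) = h (\<Gamma> y)"
    then have "(x - y) + H (\<Gamma> (x - y)) = 0"
      by (simp add: h linear_diff[OF lin] H_diff algebra_simps)
    then have "(x - y) \<bullet> \<Gamma> (x - y) + \<Gamma> (x - y) \<bullet> H (\<Gamma> (x - y)) = 0"
      by (metis (no_types) inner_add_left inner_commute inner_zero_left)
    then have "\<not> 0 < (x - y) \<bullet> \<Gamma> (x - y)" using H_pos[of "\<Gamma> (x - y)"] by linarith
    then have "x - y = 0" using pd unfolding positive_definite_def by blast
    then show "\<Gamma> x = \<Gamma> y" by simp
  qed
  then have "inv_into (range \<Gamma>) h b = \<Gamma> w"
    by (rule inv_into_f_eq) (use b in \<open>simp_all add: h H_def\<close>)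
  then show ?thesis unfolding post_cov_def h_def H_def .
qed

theorem theorem3p5:
  fixes F :: "'p::{real_inner, polish_space} \<Rightarrow> 'o::{real_inner, polish_space}"
    and \<Gamma>pr :: "'p \<Rightarrow> 'p"
    and \<Gamma>model :: "'o \<Rightarrow> 'o"
    and \<sigma> :: real
    and D :: "('o, 'm::finite) measurements"
  assumes "bounded_linear F"
    and "covariance_operator \<Gamma>pr" and "positive_definite \<Gamma>pr"
    and "covariance_operator \<Gamma>model"
    and "\<sigma>\<^sup>2 > 0"
    and "is_arg_max (design_objective \<Gamma>pr F \<Gamma>model \<sigma>) (\<lambda>O'. \<forall>j. norm (O' $ j) = 1) D"
  shows "\<exists>\<Xi> :: real ^ 'm ^ 'm. (\<forall>i j. i \<noteq> j \<longrightarrow> \<Xi> $ i $ j = 0) \<and>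
    (let Si = inv_into UNIV (noise_cov \<Gamma>model \<sigma> D);
         L = adjoint F \<circ> meas_adj D \<circ> Si;
         G = F \<circ> post_cov \<Gamma>pr F \<Gamma>model \<sigma> D \<circ> L
     in (\<lambda>a. G a - \<Gamma>model (meas_adj D (Si (meas_op D (G a))))) = (\<lambda>a. meas_adj D (\<Xi> *v a)))"
proof -
  note F = assms(1) and pr = assms(2) and pd = assms(3) and model = assms(4) and \<sigma> = assms(5)
  define S where "S = op_sqrt \<Gamma>pr"
  have S_sym: "S x \<bullet> y = x \<bullet> S y" and SS: "S (S x) = \<Gamma>pr x" for x y
    using op_sqrt[OF pr] unfolding S_def covariance_operator_def by auto
  have N: "noisy_obs \<Gamma>model (\<sigma>\<^sup>2)"
    using model \<sigma> unfolding covariance_operator_def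
    by (intro noisy_obs.intro) (auto dest: bounded_linear.linear)
  define C where "C x = \<Gamma>model x + F (\<Gamma>pr (adjoint F x))" for x
  interpret linear_gaussian_model \<Gamma>model "\<sigma>\<^sup>2" "\<lambda>x. S (adjoint F x)" "\<lambda>p. F (S p)" C
  proof (intro linear_gaussian_model.intro N linear_gaussian_model_axioms.intro)
    show "S (adjoint F x) \<bullet> p = x \<bullet> F (S p)" for x p
    proof -
      have "S (adjoint F x) \<bullet> p = S p \<bullet> adjoint F x"
        by (subst S_sym) (rule inner_commute)
      also have "\<dots> = F (S p) \<bullet> x" by (rule inner_adjoint[OF F, symmetric])
      also have "\<dots> = x \<bullet> F (S p)" by (rule inner_commute)
      finally show ?thesis .
    qed
    show "C x = \<Gamma>model x + F (S (S (adjoint F x)))" for x by (simp add: C_def SS)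
  qed
  have "\<exists>v. \<forall>u. blinfun_apply (D $ k) u = v \<bullet> u" for k
    by (rule Riesz_representation) (rule blinfun.bounded_linear_right)
  then have "\<exists>r. \<forall>k u. blinfun_apply (D $ k) u = r k \<bullet> u" by (intro choice) blast
  then obtain r where r: "\<And>k u. blinfun_apply (D $ k) u = r k \<bullet> u" by blast
  have objective: "design_objective \<Gamma>pr F \<Gamma>model \<sigma> D' = 1 / 2 * ln (op_det (precond r'))"
    if "\<And>k u. blinfun_apply (D' $ k) u = r' k \<bullet> u" for D' :: "('o, 'm) measurements" and r'
    unfolding design_objective_def misfit_hessian_eq_obs[of D' r', OF that] precond_def S_def[symmetric] ..
  have D_unit: "norm (D $ k) = 1" for k using assms(6) by (simp add: is_arg_max_def)
  have unit: "norm (r k) = 1" for k using norm_blinfun_inner[of "D $ k" "r k"] r D_unit by simp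
  have opt: "op_det (precond (r(j := v))) \<le> op_det (precond r)" if "norm v = 1" for j v
  proof -
    define D' :: "('o, 'm) measurements"
      where "D' = (\<chi> k. if k = j then blinfun_inner_right v else D $ k)"
    have r': "blinfun_apply (D' $ k) u = (r(j := v)) k \<bullet> u" for k u by (simp add: D'_def r)
    have "norm (D' $ k) = 1" for k
      using norm_blinfun_inner[of "D' $ k" "(r(j := v)) k"] r' unit that by simp
    then have "\<not> design_objective \<Gamma>pr F \<Gamma>model \<sigma> D < design_objective \<Gamma>pr F \<Gamma>model \<sigma> D'"
      using assms(6) by (auto simp: is_arg_max_def)
    then show ?thesis
      unfolding objective[of D r, OF r] objective[of D' "r(j := v)", OF r']
      using op_det_precond_pos[of r] op_det_precond_pos[of "r(j := v)"] by simp
  qed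
  obtain \<xi> where \<xi>: "\<And>a. C (obs_adj r (obs_prec C (\<sigma>\<^sup>2) r a))
      - \<Gamma>model (obs_adj r (obs_prec \<Gamma>model (\<sigma>\<^sup>2) r a)) = obs_adj r (\<chi> k. \<xi> k * a $ k)"
    using optimal_design_stationary[OF unit opt] by blast
  have lin_adj: "linear (adjoint F)"
    by (rule linear_if_inner_adjoint[of F]) (rule inner_adjoint[OF F])
  \<comment> \<open>The two forms of the Kalman gain.\<close>
  have post: "post_cov \<Gamma>pr F \<Gamma>model \<sigma> D
      (adjoint F (obs_adj r (obs_prec \<Gamma>model (\<sigma>\<^sup>2) r a)))
      = \<Gamma>pr (adjoint F (obs_adj r (obs_prec C (\<sigma>\<^sup>2) r a)))" for a
  proof (rule post_cov_eqI[OF F pr pd N r])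
    show "adjoint F (obs_adj r (obs_prec C (\<sigma>\<^sup>2) r a))
        + misfit_hessian F \<Gamma>model \<sigma> D (\<Gamma>pr (adjoint F (obs_adj r (obs_prec C (\<sigma>\<^sup>2) r a))))
        = adjoint F (obs_adj r (obs_prec \<Gamma>model (\<sigma>\<^sup>2) r a))"
      unfolding misfit_hessian_eq_obs[of D r, OF r] signal_gain[of r a, unfolded SS]
        linear_diff[OF linear_obs_adj] linear_diff[OF lin_adj] by simp
  qed
  define \<Xi> :: "real ^ 'm ^ 'm" where "\<Xi> = (\<chi> i k. if i = k then \<xi> i else 0)"
  have \<Xi>_mult: "\<Xi> *v a = (\<chi> k. \<xi> k * a $ k)" for a
    by (simp add: \<Xi>_def matrix_vector_mult_def vec_eq_iff if_distrib[of "\<lambda>c. c * _"] cong: if_cong)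
  define G where "G a = F (\<Gamma>pr (adjoint F (obs_adj r (obs_prec C (\<sigma>\<^sup>2) r a))))" for a
  have "G a - \<Gamma>model (obs_adj r (obs_prec \<Gamma>model (\<sigma>\<^sup>2) r (obs r (G a))))
      = obs_adj r (\<Xi> *v a)" for a
  proof -
    have "G a - \<Gamma>model (obs_adj r (obs_prec \<Gamma>model (\<sigma>\<^sup>2) r (obs r (G a))))
        = C (obs_adj r (obs_prec C (\<sigma>\<^sup>2) r a)) - \<Gamma>model (obs_adj r (obs_prec \<Gamma>model (\<sigma>\<^sup>2) r a))"
      unfolding G_def signal_gain[of r a, unfolded SS] linear_diff[OF linear_obs_adj]
        linear_diff[OF linear_M] C_def by simp
    then show ?thesis by (simp add: \<xi> \<Xi>_mult)
  qed
  then show ?thesis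
    unfolding meas_op_eq_obs[of D r, OF r] adjoint_obs Let_def obs_prec_def[symmetric]
    by (intro exI[of _ \<Xi>]) (auto simp: \<Xi>_def G_def post)
qed

end
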